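(* Consider the online matching algorithm on the online stochastic block model governed by the policy $\phi$ defined in the context. If NCOND holds, i.e. if $\eta>0$, then, almost surely, the online matching is perfect infinitely often (that is, $\mathbb{P}[X_t=0\text{ for infinitely many }t]=1$). If $\eta<0$, then the probability that the online matching is perfect infinitely often is zero (that is, $\mathbb{P}[X_t=0\text{ for infinitely many }t]=0$).
   Context: $\mathbb{N}_0=\{0,1,2,\dots\}$, $\mathbb{N}=\{1,2,\dots\}$. $\mathcal{C}$ is a finite set, $\nu$ a probability on $\mathcal{C}$ with $\nu(i)>0$ for all $i$, and $\rho\in[0,1]^{\mathcal{C}\times\mathcal{C}}$ a symmetric matrix. Root graph and NCOND. $\mathcal{E}_\rho(i,j)=\mathbf{1}\{\rho(i,j)>0\}$, and $\mathcal{G}_\rho=(\mathcal{C},\mathcal{E}_\rho)$ is the undirected graph (self-loops allowed) with this adjacency matrix. $\mathcal{I}\subset\mathcal{C}$ is $\mathcal{G}_\rho$-independent if $\mathcal{E}_\rho(i,j)=0$ for all $i,j\in\mathcal{I}$ (including $i=j$); $\mathbb{I}_\rho$ is the collection of non-empty $\mathcal{G}_\rho$-independent sets. $\mathcal{N}_\rho(\mathcal{A})=\{j:\mathcal{E}_\rho(i,j)=1\text{ for some }i\in\mathcal{A}\}$, $\nu(\mathcal{A})=\sum_{i\in\mathcal{A}}\nu(i)$, $\eta=\min\{\nu(\mathcal{N}_\rho(\mathcal{I}))-\nu(\mathcal{I}):\mathcal{I}\in\mathbb{I}_\rho\}$ (with $\min\emptyset=+\infty$). NCOND means $\eta>0$.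 Weight function $w:\mathbb{N}_0\times[0,1]\to[0,\infty)$, assumed to satisfy: (w1) $w(n,r)>0$ if and only if $n>0$ and $r>0$. (w2) $w$ is non-decreasing in each coordinate. (w3) For every $r\in(0,1]$ there is $m(r)\in\mathbb{N}$ such that $w(n-1,1)<w(n,r)$ and $w(n,1)<w(n+1,r)$ for every $n\ge m(r)$. Policy. Fix a bijection $\alpha:\mathcal{C}\to\{1,\dots,|\mathcal{C}|\}$. Then $\phi(x,i)=\arg\max_{j\in\mathcal{C}}(w(x(j),\rho(i,j)),\alpha(j))$ with the lexicographical order on pairs. Algorithm. Starting from the empty graph, at each time $t\ge1$ a node arrives with class $i$ drawn from $\nu$ independently of everything else, and connects to each earlier node of class $j$ independently with probability $\rho(i,j)$. Writing $X_{t-1}(j)$ for the number of unmatched nodes of class $j$ at time $t-1$, the algorithm picks the class $\phi(X_{t-1},i)$ and matches the arriving node to one of the unmatched nodes of this class to which it is connected, if there is any; otherwise no edge is added to the matching. The matching is perfect at time $t$ when no node is unmatched, i.e. $X_t=0$. Markov chain. $X=(X_t)_{t\in\mathbb{N}_0}$ is the Markov chain on $\mathbb{N}_0^{\mathcal{C}}$ with $X_0=0$ whose only non-zero transition probabilities are (with $1_i$ the canonical vector and $0^0=1$) $P(x,x+1_i)=\nu(i)(1-\rho(i,\phi(x,i)))^{x(\phi(x,i))}$, and, when $x-1_j\in\mathbb{N}_0^{\mathcal{C}}$, $P(x,x-1_j)=\sum_{i:\phi(x,i)=j}\nu(i)[1-(1-\rho(i,j))^{x(j)}]$. *)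

theory Defs
  imports "HOL-Probability.Probability"
begin

section \<open>Root graph and the constant of NCOND\<close>

definition root_edge :: "('c \<Rightarrow> 'c \<Rightarrow> real) \<Rightarrow> 'c \<Rightarrow> 'c \<Rightarrow> bool" where
  "root_edge \<rho> i j \<longleftrightarrow> \<rho> i j > 0"

definition root_independent :: "('c \<Rightarrow> 'c \<Rightarrow> real) \<Rightarrow> 'c set \<Rightarrow> bool" where
  "root_independent \<rho> I \<longleftrightarrow> (\<forall>i\<in>I. \<forall>j\<in>I. \<not> root_edge \<rho> i j)"

definition root_nbhd :: "('c \<Rightarrow> 'c \<Rightarrow> real) \<Rightarrow> 'c set \<Rightarrow> 'c set" where
  "root_nbhd \<rho> A = {j. \<exists>i\<in>A. root_edge \<rho> i j}"

text \<open>For a finite class set the infimum is a minimum, and over the empty family it is \<open>\<infinity>\<close>.\<close>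

definition ncond_eta :: "'c::finite pmf \<Rightarrow> ('c \<Rightarrow> 'c \<Rightarrow> real) \<Rightarrow> ereal" where
  "ncond_eta \<nu> \<rho> = (INF I \<in> {I. I \<noteq> {} \<and> root_independent \<rho> I}.
     ereal ((\<Sum>j\<in>root_nbhd \<rho> I. pmf \<nu> j) - (\<Sum>i\<in>I. pmf \<nu> i)))"

section \<open>Weight functions and the policy\<close>

text \<open>Only the values \<open>w n r\<close> with \<open>r \<in> [0,1]\<close> are constrained (and used).\<close>

definition weight_function :: "(nat \<Rightarrow> real \<Rightarrow> real) \<Rightarrow> bool" where
  "weight_function w \<longleftrightarrow>
     (\<forall>n. \<forall>r\<in>{0..1}. 0 \<le> w n r) \<and>
     (\<forall>n. \<forall>r\<in>{0..1}. w n r > 0 \<longleftrightarrow> n > 0 \<and> r > 0) \<and>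
     (\<forall>n n'. \<forall>r\<in>{0..1}. n \<le> n' \<longrightarrow> w n r \<le> w n' r) \<and>
     (\<forall>n. \<forall>r\<in>{0..1}. \<forall>r'\<in>{0..1}. r \<le> r' \<longrightarrow> w n r \<le> w n r') \<and>
     (\<forall>r\<in>{0<..1}. \<exists>m\<ge>1. \<forall>n\<ge>m. w (n - 1) 1 < w n r \<and> w n 1 < w (n + 1) r)"

text \<open>The argmax of \<open>(w (x j) (\<rho> i j), \<alpha> j)\<close> in the lexicographic order; it exists and is unique
  when \<open>\<alpha>\<close> is injective.\<close>

definition policy ::
  "(nat \<Rightarrow> real \<Rightarrow> real) \<Rightarrow> ('c::finite \<Rightarrow> 'c \<Rightarrow> real) \<Rightarrow> ('c \<Rightarrow> nat) \<Rightarrow> ('c \<Rightarrow> nat) \<Rightarrow> 'c \<Rightarrow> 'c" where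
  "policy w \<rho> \<alpha> x i = (THE j. \<forall>k.
     w (x k) (\<rho> i k) < w (x j) (\<rho> i j) \<or>
     w (x k) (\<rho> i k) = w (x j) (\<rho> i j) \<and> \<alpha> k \<le> \<alpha> j)"

section \<open>Markov chains\<close>

text \<open>\<open>X\<close> is a Markov chain on \<open>M\<close> started at \<open>x0\<close> whose transitions between single states have
  probabilities \<open>P\<close>.  It is only used for \<open>P\<close> with countably supported rows summing to one, which
  makes the statement about singletons sufficient on any state space.\<close>

definition markov_chain ::
  "'w measure \<Rightarrow> (nat \<Rightarrow> 'w \<Rightarrow> 's) \<Rightarrow> 's \<Rightarrow> ('s \<Rightarrow> 's \<Rightarrow> real) \<Rightarrow> bool" where
  "markov_chain M X x0 P \<longleftrightarrow>
     prob_space M \<and>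
     (\<forall>t. X t \<in> M \<rightarrow>\<^sub>M count_space UNIV) \<and>
     (AE \<omega> in M. X 0 \<omega> = x0) \<and>
     (\<forall>t x. measure M {\<omega> \<in> space M. \<forall>s\<le>Suc t. X s \<omega> = x s} =
            measure M {\<omega> \<in> space M. \<forall>s\<le>t. X s \<omega> = x s} * P (x t) (x (Suc t)))"

section \<open>The online matching algorithm\<close>

text \<open>The configuration after \<open>t\<close> arrivals: the nodes are \<open>0, \<dots>, t - 1\<close> in order of arrival, the
  class of node \<open>k\<close> is \<open>classes g ! k\<close>, and edges are two-element sets of nodes.\<close>

datatype 'c config =
  Config (classes: "'c list") (edges: "nat set set") (matching: "nat set set")

abbreviation empty_config :: "'c config" where
  "empty_config \<equiv> Config [] {} {}"

definition unmatched :: "'c config \<Rightarrow> nat set" where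
  "unmatched g = {k. k < length (classes g) \<and> k \<notin> \<Union> (matching g)}"

definition unmatched_count :: "'c config \<Rightarrow> 'c \<Rightarrow> nat" where
  "unmatched_count g j = card {k \<in> unmatched g. classes g ! k = j}"

definition neighbours_pmf :: "('c \<Rightarrow> 'c \<Rightarrow> real) \<Rightarrow> 'c config \<Rightarrow> 'c \<Rightarrow> nat set pmf" where
  "neighbours_pmf \<rho> g i = map_pmf (\<lambda>b. {k. k < length (classes g) \<and> b k})
     (Pi_pmf {..<length (classes g)} False (\<lambda>k. bernoulli_pmf (\<rho> i (classes g ! k))))"

text \<open>The nodes with which an arriving node of class \<open>i\<close> and neighbour set \<open>N\<close> may be matched.\<close>

definition candidates ::
  "(nat \<Rightarrow> real \<Rightarrow> real) \<Rightarrow> ('c::finite \<Rightarrow> 'c \<Rightarrow> real) \<Rightarrow> ('c \<Rightarrow> nat) \<Rightarrow>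
     'c config \<Rightarrow> 'c \<Rightarrow> nat set \<Rightarrow> nat set" where
  "candidates w \<rho> \<alpha> g i N =
     {k \<in> unmatched g. classes g ! k = policy w \<rho> \<alpha> (unmatched_count g) i \<and> k \<in> N}"

text \<open>How the algorithm picks one of several candidates is left open: the choice may be random and
  may depend on the whole past and on the current arrival.\<close>

definition selection_rule ::
  "(nat \<Rightarrow> real \<Rightarrow> real) \<Rightarrow> ('c::finite \<Rightarrow> 'c \<Rightarrow> real) \<Rightarrow> ('c \<Rightarrow> nat) \<Rightarrow>
     ('c config \<Rightarrow> 'c \<Rightarrow> nat set \<Rightarrow> nat pmf) \<Rightarrow> bool" where
  "selection_rule w \<rho> \<alpha> sel \<longleftrightarrow> (\<forall>g i N. candidates w \<rho> \<alpha> g i N \<noteq> {} \<longrightarrow>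
     set_pmf (sel g i N) \<subseteq> candidates w \<rho> \<alpha> g i N)"

definition arrival_step ::
  "'c::finite pmf \<Rightarrow> ('c \<Rightarrow> 'c \<Rightarrow> real) \<Rightarrow> (nat \<Rightarrow> real \<Rightarrow> real) \<Rightarrow> ('c \<Rightarrow> nat) \<Rightarrow>
     ('c config \<Rightarrow> 'c \<Rightarrow> nat set \<Rightarrow> nat pmf) \<Rightarrow> 'c config \<Rightarrow> 'c config pmf" where
  "arrival_step \<nu> \<rho> w \<alpha> sel g =
     bind_pmf \<nu> (\<lambda>i. bind_pmf (neighbours_pmf \<rho> g i) (\<lambda>N.
       let n = length (classes g) in
       map_pmf (Config (classes g @ [i]) (edges g \<union> {{k, n} |k. k \<in> N}))
         (if candidates w \<rho> \<alpha> g i N = {} then return_pmf (matching g)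
          else map_pmf (\<lambda>k. insert {k, n} (matching g)) (sel g i N))))"

definition online_matching ::
  "'c::finite pmf \<Rightarrow> ('c \<Rightarrow> 'c \<Rightarrow> real) \<Rightarrow> (nat \<Rightarrow> real \<Rightarrow> real) \<Rightarrow> ('c \<Rightarrow> nat) \<Rightarrow>
     ('c config \<Rightarrow> 'c \<Rightarrow> nat set \<Rightarrow> nat pmf) \<Rightarrow> 'w measure \<Rightarrow> (nat \<Rightarrow> 'w \<Rightarrow> 'c config) \<Rightarrow> bool" where
  "online_matching \<nu> \<rho> w \<alpha> sel M G \<longleftrightarrow>
     markov_chain M G empty_config (\<lambda>g. pmf (arrival_step \<nu> \<rho> w \<alpha> sel g))"

section \<open>The chain of unmatched nodes per class\<close>

text \<open>Two states are related by at most one of the moves \<open>x + 1\<^sub>i\<close>, \<open>x - 1\<^sub>j\<close>, so at most one summand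
  is non-zero.\<close>

definition transition ::
  "'c::finite pmf \<Rightarrow> ('c \<Rightarrow> 'c \<Rightarrow> real) \<Rightarrow> (nat \<Rightarrow> real \<Rightarrow> real) \<Rightarrow> ('c \<Rightarrow> nat) \<Rightarrow>
     ('c \<Rightarrow> nat) \<Rightarrow> ('c \<Rightarrow> nat) \<Rightarrow> real" where
  "transition \<nu> \<rho> w \<alpha> x y =
     (\<Sum>i\<in>UNIV. if y = x(i := x i + 1)
        then pmf \<nu> i * (1 - \<rho> i (policy w \<rho> \<alpha> x i)) ^ x (policy w \<rho> \<alpha> x i) else 0) +
     (\<Sum>j\<in>UNIV. if x j > 0 \<and> y = x(j := x j - 1)
        then \<Sum>i | policy w \<rho> \<alpha> x i = j. pmf \<nu> i * (1 - (1 - \<rho> i j) ^ x j) else 0)"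

text \<open>The rest of this theory shows that the per-class numbers of unmatched nodes of the algorithm
  form a Markov chain with these transition probabilities, whatever the selection rule.\<close>

lemma unmatched_count_eq_0_iff: "unmatched_count g = (\<lambda>_. 0) \<longleftrightarrow> unmatched g = {}"
proof -
  have fin: "finite (unmatched g)" by (simp add: unmatched_def)
  show ?thesis by (auto simp: unmatched_count_def fun_eq_iff fin)
qed

definition valid_config :: "'c config \<Rightarrow> bool" where
  "valid_config g \<longleftrightarrow> \<Union> (matching g) \<subseteq> {..<length (classes g)}"

lemma finite_unmatched [simp]: "finite (unmatched g)"
  by (simp add: unmatched_def)

lemma unmatched_count_keep:
  assumes "valid_config g"
  shows "unmatched_count (Config (classes g @ [i]) E (matching g)) =
         (unmatched_count g)(i := unmatched_count g i + 1)"
proof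
  fix j
  let ?n = "length (classes g)"
  have n: "?n \<notin> \<Union> (matching g)" using assms by (auto simp: valid_config_def)
  have "{k \<in> unmatched (Config (classes g @ [i]) E (matching g)). (classes g @ [i]) ! k = j} =
        {k \<in> unmatched g. classes g ! k = j} \<union> (if i = j then {?n} else {})"
  proof (rule set_eqI)
    fix k
    show "k \<in> {k \<in> unmatched (Config (classes g @ [i]) E (matching g)). (classes g @ [i]) ! k = j} \<longleftrightarrow>
        k \<in> {k \<in> unmatched g. classes g ! k = j} \<union> (if i = j then {?n} else {})"
      using n by (cases "k < ?n"; cases "k = ?n") (simp_all add: unmatched_def nth_append)
  qed
  moreover have "?n \<notin> {k \<in> unmatched g. classes g ! k = j}" by (simp add: unmatched_def)
  ultimately show "unmatched_count (Config (classes g @ [i]) E (matching g)) j =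
         ((unmatched_count g)(i := unmatched_count g i + 1)) j"
    by (auto simp: unmatched_count_def)
qed

lemma unmatched_count_match:
  assumes "valid_config g" "k \<in> unmatched g" "classes g ! k = c"
  shows "unmatched_count (Config (classes g @ [i]) E (insert {k, length (classes g)} (matching g))) =
         (unmatched_count g)(c := unmatched_count g c - 1)"
proof
  fix j
  let ?n = "length (classes g)"
  let ?g = "Config (classes g @ [i]) E (insert {k, ?n} (matching g))"
  have "{l \<in> unmatched ?g. (classes g @ [i]) ! l = j} = {l \<in> unmatched g. classes g ! l = j} - {k}"
    by (auto simp: unmatched_def nth_append less_Suc_eq split: if_splits)
  then show "unmatched_count ?g j = ((unmatched_count g)(c := unmatched_count g c - 1)) j"
    using assms(2,3) by (auto simp: unmatched_count_def card_Diff_singleton_if)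
qed

lemma valid_arrival_step:
  assumes "valid_config g" "selection_rule w \<rho> \<alpha> sel" "h \<in> set_pmf (arrival_step \<nu> \<rho> w \<alpha> sel g)"
  shows "valid_config h"
proof -
  obtain i N where h: "h \<in> set_pmf (map_pmf (Config (classes g @ [i])
      (edges g \<union> {{k, length (classes g)} |k. k \<in> N}))
         (if candidates w \<rho> \<alpha> g i N = {} then return_pmf (matching g)
          else map_pmf (\<lambda>k. insert {k, length (classes g)} (matching g)) (sel g i N)))"
    using assms(3) by (auto simp: arrival_step_def Let_def)
  show ?thesis
  proof (cases "candidates w \<rho> \<alpha> g i N = {}")
    case True
    then show ?thesis using h assms(1) by (auto simp: valid_config_def)
  next
    case False
    then have "set_pmf (sel g i N) \<subseteq> candidates w \<rho> \<alpha> g i N"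
      using assms(2) by (simp add: selection_rule_def)
    then have "\<And>k. k \<in> set_pmf (sel g i N) \<Longrightarrow> k < length (classes g)"
      by (auto simp: candidates_def unmatched_def)
    moreover have "\<exists>k\<in>set_pmf (sel g i N). classes h = classes g @ [i] \<and>
        matching h = insert {k, length (classes g)} (matching g)"
      using h False by auto
    ultimately obtain k where k: "k < length (classes g)" "classes h = classes g @ [i]"
        "matching h = insert {k, length (classes g)} (matching g)"
      by blast
    have "\<Union> (matching g) \<subseteq> {..<Suc (length (classes g))}"
      using assms(1) by (auto simp: valid_config_def intro: less_SucI)
    then show ?thesis using k by (simp add: valid_config_def)
  qed
qed

lemma prob_no_candidates:
  assumes "\<And>i j. \<rho> i j \<in> {0..1}"
  shows "measure_pmf.prob (neighbours_pmf \<rho> g i) {N. candidates w \<rho> \<alpha> g i N = {}} =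
    (let c = policy w \<rho> \<alpha> (unmatched_count g) i in (1 - \<rho> i c) ^ unmatched_count g c)"
proof -
  define c where "c = policy w \<rho> \<alpha> (unmatched_count g) i"
  let ?n = "length (classes g)"
  let ?U = "{k \<in> unmatched g. classes g ! k = c}"
  let ?p = "\<lambda>k. bernoulli_pmf (\<rho> i (classes g ! k))"
  let ?B = "\<lambda>k. if k \<in> ?U then {False} else UNIV"
  have vim: "(\<lambda>b. {k. k < ?n \<and> b k}) -` {N. candidates w \<rho> \<alpha> g i N = {}} = Pi {..<?n} ?B"
    by (auto simp: candidates_def c_def[symmetric] unmatched_def Pi_def split: if_splits)
  have "measure_pmf.prob (neighbours_pmf \<rho> g i) {N. candidates w \<rho> \<alpha> g i N = {}} =
      measure_pmf.prob (Pi_pmf {..<?n} False ?p) (Pi {..<?n} ?B)"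
    by (simp only: neighbours_pmf_def measure_map_pmf vim)
  also have "\<dots> = (\<Prod>k\<in>{..<?n}. measure_pmf.prob (?p k) (?B k))"
    by (rule measure_Pi_pmf_Pi) simp
  also have "\<dots> = (\<Prod>k\<in>{..<?n}. if k \<in> ?U then 1 - \<rho> i c else 1)"
  proof (rule prod.cong[OF refl])
    fix k
    show "measure_pmf.prob (?p k) (?B k) = (if k \<in> ?U then 1 - \<rho> i c else 1)"
      using assms[of i c] by (auto simp: measure_pmf_single measure_pmf.prob_space[simplified])
  qed
  also have "\<dots> = (\<Prod>k\<in>?U. 1 - \<rho> i c)"
    by (rule prod.mono_neutral_cong_right) (auto simp: unmatched_def)
  finally show ?thesis by (simp add: Let_def c_def[symmetric] unmatched_count_def)
qed

lemma pmf_unmatched_count_arrival_step: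
  fixes g :: "'c::finite config"
  assumes \<rho>: "\<And>i j. \<rho> i j \<in> {0..1}" and valid: "valid_config g" and sel: "selection_rule w \<rho> \<alpha> sel"
  shows "pmf (map_pmf unmatched_count (arrival_step \<nu> \<rho> w \<alpha> sel g)) y =
    transition \<nu> \<rho> w \<alpha> (unmatched_count g) y"
proof -
  define x where "x = unmatched_count g"
  define \<phi> where "\<phi> i = policy w \<rho> \<alpha> x i" for i
  let ?n = "length (classes g)"
  define up where "up i = x(i := x i + 1)" for i
  define down where "down i = x(\<phi> i := x (\<phi> i) - 1)" for i
  define q where "q i = (1 - \<rho> i (\<phi> i)) ^ x (\<phi> i)" for i
  have inner: "map_pmf unmatched_count (map_pmf (Config (classes g @ [i]) E)
         (if candidates w \<rho> \<alpha> g i N = {} then return_pmf (matching g)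
          else map_pmf (\<lambda>k. insert {k, ?n} (matching g)) (sel g i N))) =
      return_pmf (if candidates w \<rho> \<alpha> g i N = {} then up i else down i)" for i N E
  proof (cases "candidates w \<rho> \<alpha> g i N = {}")
    case True
    then show ?thesis using unmatched_count_keep[OF valid] by (simp add: up_def x_def)
  next
    case False
    have "unmatched_count (Config (classes g @ [i]) E (insert {k, ?n} (matching g))) = down i"
      if "k \<in> set_pmf (sel g i N)" for k
    proof -
      have "k \<in> candidates w \<rho> \<alpha> g i N" using that False sel by (auto simp: selection_rule_def)
      then show ?thesis using unmatched_count_match[OF valid, of k "\<phi> i" i E]
        by (simp add: candidates_def down_def \<phi>_def x_def)
    qed
    then have "map_pmf (\<lambda>k. unmatched_count (Config (classes g @ [i]) E (insert {k, ?n} (matching g))))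
        (sel g i N) = map_pmf (\<lambda>_. down i) (sel g i N)"
      by (intro map_pmf_cong) auto
    then show ?thesis using False by (simp add: pmf.map_comp o_def)
  qed
  have "map_pmf unmatched_count (arrival_step \<nu> \<rho> w \<alpha> sel g) =
      bind_pmf \<nu> (\<lambda>i. map_pmf (\<lambda>N. if candidates w \<rho> \<alpha> g i N = {} then up i else down i)
        (neighbours_pmf \<rho> g i))"
    unfolding arrival_step_def Let_def map_bind_pmf inner by (simp add: map_pmf_def)
  then have "pmf (map_pmf unmatched_count (arrival_step \<nu> \<rho> w \<alpha> sel g)) y =
      (\<Sum>i\<in>UNIV. pmf \<nu> i * measure_pmf.prob (neighbours_pmf \<rho> g i)
        {N. (if candidates w \<rho> \<alpha> g i N = {} then up i else down i) = y})"
    by (simp add: pmf_bind integral_measure_pmf[of UNIV] pmf_map vimage_def)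
  also have "\<dots> = (\<Sum>i\<in>UNIV. (if y = up i then pmf \<nu> i * q i else 0) +
      (if y = down i then pmf \<nu> i * (1 - q i) else 0))"
  proof (rule sum.cong[OF refl])
    fix i
    let ?A = "{N. candidates w \<rho> \<alpha> g i N = {}}"
    let ?Q = "measure_pmf.prob (neighbours_pmf \<rho> g i)"
    have A: "?Q ?A = q i"
      using prob_no_candidates[OF \<rho>, where g=g and i=i and w=w and \<alpha>=\<alpha>] by (simp add: q_def \<phi>_def x_def Let_def)
    have A': "?Q (- ?A) = 1 - q i"
      using measure_pmf.prob_compl[of ?A "neighbours_pmf \<rho> g i"] A by (simp add: Compl_eq_Diff_UNIV)
    have ne: "up i \<noteq> down i"
    proof
      assume "up i = down i"
      then have "up i i = down i i" by simp
      then show False by (auto simp: up_def down_def split: if_splits)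
    qed
    have "{N. (if candidates w \<rho> \<alpha> g i N = {} then up i else down i) = y} =
        (if y = up i then ?A else if y = down i then - ?A else {})"
      using ne by auto
    then show "pmf \<nu> i * ?Q {N. (if candidates w \<rho> \<alpha> g i N = {} then up i else down i) = y} =
        (if y = up i then pmf \<nu> i * q i else 0) + (if y = down i then pmf \<nu> i * (1 - q i) else 0)"
      using ne A A' by simp
  qed
  also have "\<dots> = (\<Sum>i\<in>UNIV. if y = up i then pmf \<nu> i * q i else 0) +
      (\<Sum>i\<in>UNIV. if y = down i then pmf \<nu> i * (1 - q i) else 0)"
    by (rule sum.distrib)
  also have "(\<Sum>i\<in>UNIV. if y = down i then pmf \<nu> i * (1 - q i) else 0) =
      (\<Sum>j\<in>UNIV. \<Sum>i | \<phi> i = j. if y = down i then pmf \<nu> i * (1 - q i) else 0)"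
    using sum.group[of UNIV UNIV \<phi> "\<lambda>i. if y = down i then pmf \<nu> i * (1 - q i) else 0"] by simp
  also have "\<dots> = (\<Sum>j\<in>UNIV. if x j > 0 \<and> y = x(j := x j - 1)
        then \<Sum>i | \<phi> i = j. pmf \<nu> i * (1 - (1 - \<rho> i j) ^ x j) else 0)"
    by (intro sum.cong) (auto simp: down_def q_def intro!: sum.neutral)
  finally show ?thesis
    by (simp only: transition_def x_def[symmetric] \<phi>_def q_def up_def)
qed

text \<open>The law of the first \<open>t + 1\<close> states of a chain with kernel \<open>K\<close>.\<close>

primrec trajectory_pmf :: "'s \<Rightarrow> ('s \<Rightarrow> 's pmf) \<Rightarrow> nat \<Rightarrow> 's list pmf" where
  "trajectory_pmf x0 K 0 = return_pmf [x0]"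
| "trajectory_pmf x0 K (Suc t) =
     bind_pmf (trajectory_pmf x0 K t) (\<lambda>h. map_pmf (\<lambda>y. h @ [y]) (K (last h)))"

lemma trajectory_pmf_length: "h \<in> set_pmf (trajectory_pmf x0 K t) \<Longrightarrow> length h = Suc t"
  by (induction t arbitrary: h) auto

lemma trajectory_pmf_invariant:
  assumes "I x0" and step: "\<And>x y. I x \<Longrightarrow> y \<in> set_pmf (K x) \<Longrightarrow> I y"
  shows "h \<in> set_pmf (trajectory_pmf x0 K t) \<Longrightarrow> I (last h)"
  using assms(1) by (induction t arbitrary: h) (auto, metis step)

lemma markov_chain_trajectory_singleton:
  assumes mc: "markov_chain M X x0 (\<lambda>x. pmf (K x))"
  shows "measure M {\<omega> \<in> space M. \<forall>s\<le>t. X s \<omega> = x s} = pmf (trajectory_pmf x0 K t) (map x [0..<Suc t])"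
proof -
  interpret prob_space M using mc by (simp add: markov_chain_def)
  have meas [measurable]: "X s \<in> M \<rightarrow>\<^sub>M count_space UNIV" for s using mc by (simp add: markov_chain_def)
  show ?thesis
  proof (induction t)
    case 0
    have AE0: "AE \<omega> in M. X 0 \<omega> = x0" using mc by (simp add: markov_chain_def)
    have "prob {\<omega> \<in> space M. X 0 \<omega> = x 0} = (if x 0 = x0 then 1 else 0)"
    proof (cases "x 0 = x0")
      case True
      then show ?thesis using AE0 by (simp add: prob_Collect_eq_1)
    next
      case False
      have "AE \<omega> in M. X 0 \<omega> \<noteq> x 0" using AE0 by eventually_elim (use False in auto)
      then show ?thesis using False by (simp add: prob_Collect_eq_0)
    qed
    then show ?case by (auto simp: indicator_def)
  next
    case (Suc t)
    let ?h = "map x [0..<Suc t]"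
    have "pmf (trajectory_pmf x0 K (Suc t)) (map x [0..<Suc (Suc t)]) =
        (\<integral>h. pmf (map_pmf (\<lambda>y. h @ [y]) (K (last h))) (?h @ [x (Suc t)]) \<partial>trajectory_pmf x0 K t)"
      by (simp add: pmf_bind)
    also have "\<dots> = (\<integral>h. (if h = ?h then pmf (K (x t)) (x (Suc t)) else 0) \<partial>trajectory_pmf x0 K t)"
    proof (rule Bochner_Integration.integral_cong[OF refl])
      fix h
      have "(\<lambda>y. h @ [y]) -` {?h @ [x (Suc t)]} = (if h = ?h then {x (Suc t)} else {})"
        by (auto simp del: upt_Suc)
      moreover have "last ?h = x t" by simp
      ultimately show "pmf (map_pmf (\<lambda>y. h @ [y]) (K (last h))) (?h @ [x (Suc t)]) =
          (if h = ?h then pmf (K (x t)) (x (Suc t)) else 0)"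
        by (auto simp: pmf_map measure_pmf_single simp del: upt_Suc)
    qed
    also have "\<dots> = pmf (trajectory_pmf x0 K t) ?h * pmf (K (x t)) (x (Suc t))"
      by (subst integral_measure_pmf[of "{?h}"]) (auto split: if_splits simp del: upt_Suc)
    finally show ?case
      using Suc.IH mc by (simp add: markov_chain_def del: upt_Suc)
  qed
qed

lemma markov_chain_trajectory:
  assumes mc: "markov_chain M X x0 (\<lambda>x. pmf (K x))"
    and A: "{\<omega> \<in> space M. map (\<lambda>s. X s \<omega>) [0..<Suc t] \<in> A} \<in> sets M"
  shows "measure M {\<omega> \<in> space M. map (\<lambda>s. X s \<omega>) [0..<Suc t] \<in> A} =
    measure_pmf.prob (trajectory_pmf x0 K t) A"
proof -
  interpret prob_space M using mc by (simp add: markov_chain_def)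
  have meas [measurable]: "X s \<in> M \<rightarrow>\<^sub>M count_space UNIV" for s using mc by (simp add: markov_chain_def)
  let ?T = "trajectory_pmf x0 K t"
  define H where "H \<omega> = map (\<lambda>s. X s \<omega>) [0..<Suc t]" for \<omega>
  have H_eq: "{\<omega> \<in> space M. H \<omega> = h} = (if length h = Suc t
      then {\<omega> \<in> space M. \<forall>s\<le>t. X s \<omega> = h ! s} else {})" for h
    by (auto simp: H_def list_eq_iff_nth_eq less_Suc_eq_le simp del: upt_Suc)
  have H_sets: "{\<omega> \<in> space M. H \<omega> = h} \<in> sets M" for h
    unfolding H_eq by simp
  have single: "prob {\<omega> \<in> space M. H \<omega> = h} = pmf ?T h" for h
  proof (cases "length h = Suc t")
    case True
    then have "map ((!) h) [0..<Suc t] = h" by (metis map_nth)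
    then show ?thesis using markov_chain_trajectory_singleton[OF mc, of t "(!) h"] True
      by (simp add: H_eq del: upt_Suc)
  next
    case False
    then have "h \<notin> set_pmf ?T" using trajectory_pmf_length by metis
    then show ?thesis using False by (simp add: H_eq set_pmf_iff)
  qed
  have ge: "measure_pmf.prob ?T B \<le> prob {\<omega> \<in> space M. H \<omega> \<in> B}"
    if B: "{\<omega> \<in> space M. H \<omega> \<in> B} \<in> sets M" for B
  proof -
    let ?C = "B \<inter> set_pmf ?T"
    have cnt: "countable ?C" by simp
    have "emeasure ?T B = emeasure ?T ?C" by (simp add: emeasure_Int_set_pmf)
    also have "\<dots> = (\<integral>\<^sup>+h. emeasure ?T {h} \<partial>count_space ?C)"
      by (rule emeasure_countable_singleton) auto
    also have "\<dots> = (\<integral>\<^sup>+h. emeasure M {\<omega> \<in> space M. H \<omega> = h} \<partial>count_space ?C)"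
      by (simp add: emeasure_pmf_single emeasure_eq_measure single)
    also have "\<dots> = emeasure M (\<Union>h\<in>?C. {\<omega> \<in> space M. H \<omega> = h})"
      by (rule emeasure_UN_countable[symmetric]) (auto simp: H_sets disjoint_family_on_def)
    also have "\<dots> \<le> emeasure M {\<omega> \<in> space M. H \<omega> \<in> B}"
      by (rule emeasure_mono[OF _ B]) auto
    finally show ?thesis
      by (simp add: emeasure_eq_measure measure_pmf.emeasure_eq_measure)
  qed
  have A': "{\<omega> \<in> space M. H \<omega> \<in> A} \<in> sets M" using A by (simp add: H_def del: upt_Suc)
  have compl: "{\<omega> \<in> space M. H \<omega> \<in> - A} = space M - {\<omega> \<in> space M. H \<omega> \<in> A}" by auto
  have "measure_pmf.prob ?T (- A) \<le> prob {\<omega> \<in> space M. H \<omega> \<in> - A}"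
    by (rule ge) (use A' in \<open>simp only: compl sets.compl_sets\<close>)
  also have "\<dots> = 1 - prob {\<omega> \<in> space M. H \<omega> \<in> A}"
    unfolding compl by (rule prob_compl[OF A'])
  finally have "prob {\<omega> \<in> space M. H \<omega> \<in> A} \<le> measure_pmf.prob ?T A"
    using measure_pmf.prob_compl[of A ?T] by (simp add: Compl_eq_Diff_UNIV)
  with ge[OF A'] show ?thesis by (simp add: H_def del: upt_Suc)
qed

theorem markov_chain_unmatched_count:
  fixes \<nu> :: "'c::finite pmf"
  assumes \<rho>: "\<And>i j. \<rho> i j \<in> {0..1}" and sel: "selection_rule w \<rho> \<alpha> sel"
    and om: "online_matching \<nu> \<rho> w \<alpha> sel M G"
  shows "markov_chain M (\<lambda>t \<omega>. unmatched_count (G t \<omega>)) (\<lambda>_. 0) (transition \<nu> \<rho> w \<alpha>)"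
proof -
  define K where "K = arrival_step \<nu> \<rho> w \<alpha> sel"
  have mc: "markov_chain M G empty_config (\<lambda>g. pmf (K g))"
    using om by (simp add: online_matching_def K_def)
  interpret prob_space M using mc by (simp add: markov_chain_def)
  have meas [measurable]: "G s \<in> M \<rightarrow>\<^sub>M count_space UNIV" for s using mc by (simp add: markov_chain_def)
  have meas' [measurable]: "(\<lambda>\<omega>. unmatched_count (G s \<omega>)) \<in> M \<rightarrow>\<^sub>M count_space UNIV" for s
    by (rule measurable_compose[OF meas]) simp
  have AE0: "AE \<omega> in M. unmatched_count (G 0 \<omega>) = (\<lambda>_. 0)"
  proof -
    have "AE \<omega> in M. G 0 \<omega> = empty_config" using mc by (simp add: markov_chain_def)
    then show ?thesis
      by eventually_elim (simp add: unmatched_count_eq_0_iff unmatched_def)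
  qed
  have step: "prob {\<omega> \<in> space M. \<forall>s\<le>Suc t. unmatched_count (G s \<omega>) = x s} =
      prob {\<omega> \<in> space M. \<forall>s\<le>t. unmatched_count (G s \<omega>) = x s} *
      transition \<nu> \<rho> w \<alpha> (x t) (x (Suc t))" for t x
  proof -
    let ?T = "trajectory_pmf empty_config K"
    define A where "A u = {h. \<forall>s\<le>u. unmatched_count (h ! s) = x s}" for u
    have ev: "{\<omega> \<in> space M. \<forall>s\<le>u. unmatched_count (G s \<omega>) = x s} =
        {\<omega> \<in> space M. map (\<lambda>s. G s \<omega>) [0..<Suc u] \<in> A u}" for u
      by (auto simp: A_def less_Suc_eq_le simp del: upt_Suc)
    have law: "prob {\<omega> \<in> space M. \<forall>s\<le>u. unmatched_count (G s \<omega>) = x s} =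
        measure_pmf.prob (?T u) (A u)" for u
      unfolding ev by (rule markov_chain_trajectory[OF mc]) (simp only: ev[symmetric], measurable)
    have "measure_pmf.prob (?T (Suc t)) (A (Suc t)) =
        (\<integral>h. measure_pmf.prob (map_pmf (\<lambda>y. h @ [y]) (K (last h))) (A (Suc t)) \<partial>?T t)"
      using pmf_bind[of "?T t" "\<lambda>h. map_pmf (\<lambda>y. h @ [y] \<in> A (Suc t)) (K (last h))" True]
        pmf_map[of "\<lambda>h. h \<in> A (Suc t)" "?T (Suc t)" True]
      by (simp add: map_bind_pmf pmf.map_comp o_def pmf_map vimage_def)
    also have "\<dots> = (\<integral>h. indicator (A t) h * transition \<nu> \<rho> w \<alpha> (x t) (x (Suc t)) \<partial>?T t)"
    proof (rule integral_cong_AE)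
      show "AE h in ?T t. measure_pmf.prob (map_pmf (\<lambda>y. h @ [y]) (K (last h))) (A (Suc t)) =
          indicator (A t) h * transition \<nu> \<rho> w \<alpha> (x t) (x (Suc t))"
      proof (rule AE_pmfI)
        fix h assume h: "h \<in> set_pmf (?T t)"
        have len: "length h = Suc t" using trajectory_pmf_length[OF h] .
        have "valid_config (last h)"
          by (rule trajectory_pmf_invariant[OF _ _ h])
            (auto simp: K_def valid_config_def[of empty_config] intro: valid_arrival_step[OF _ sel])
        then have tr: "measure_pmf.prob (K (last h)) (unmatched_count -` {x (Suc t)}) =
            transition \<nu> \<rho> w \<alpha> (unmatched_count (last h)) (x (Suc t))"
          using pmf_unmatched_count_arrival_step[OF \<rho> _ sel, of "last h" \<nu> "x (Suc t)"]
          by (simp add: K_def pmf_map)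
        have last: "last h = h ! t" using len by (metis diff_Suc_1 last_conv_nth length_0_conv nat.distinct(1))
        have "(\<lambda>y. h @ [y]) -` A (Suc t) = (if h \<in> A t then unmatched_count -` {x (Suc t)} else {})"
          using len by (auto simp: A_def le_Suc_eq nth_append)
        then show "measure_pmf.prob (map_pmf (\<lambda>y. h @ [y]) (K (last h))) (A (Suc t)) =
            indicator (A t) h * transition \<nu> \<rho> w \<alpha> (x t) (x (Suc t))"
          using tr last by (auto simp: A_def)
      qed
    qed auto
    also have "\<dots> = measure_pmf.prob (?T t) (A t) * transition \<nu> \<rho> w \<alpha> (x t) (x (Suc t))"
      by simp
    finally show ?thesis by (simp only: law)
  qed
  show ?thesis
    unfolding markov_chain_def using step AE0 meas' prob_space_axioms by blast
qed

end

theory Submission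
  imports Defs
begin

text \<open>The numbers of unmatched nodes per class form a Markov chain on the finitely supported kernel
\<open>step_pmf\<close>, so both claims are statements about how often a chain visits its starting point \<open>0\<close>.

\<^bold>\<open>Recurrence when \<open>\<eta> > 0\<close>.\<close>  A non-negative function \<open>W\<close> that decreases by at least \<open>1\<close> in mean from every
state other than \<open>0\<close> bounds the expected time between any fixed time and the next visit to \<open>0\<close>, so
\<open>0\<close> is visited after every fixed time (\<open>markov_chain_recurrent_if_drift\<close>).  The main part of \<open>W\<close> is
\<open>V x = \<Sum>\<^sub>j (x j)\<^sup>2\<close>.  An arrival of class \<open>i\<close> that is matched lowers \<open>V\<close> by about \<open>2 x(\<phi>(x, i))\<close>, one that
is not raises it by about \<open>2 x i\<close>.  For long queues an extra node outweighs any difference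
in edge probability, so \<open>\<phi>(x, i)\<close> is a longest queue among the neighbours of \<open>i\<close> as soon as some
neighbouring queue is long, and then the arrival is matched with a probability exponentially close
to \<open>1\<close>.  Hence up to bounded and relatively small errors the drift of \<open>V\<close> is
\<open>- 2 \<Sum>\<^sub>i \<nu>(i) (M\<^sub>i - [M\<^sub>i < K] x i)\<close>, where \<open>M\<^sub>i\<close> is the longest queue among the neighbours of \<open>i\<close>.
Cut this sum into horizontal layers: at a level \<open>t \<ge> K\<close> it compares the mass of the neighbourhood of
\<open>{i. t < x i}\<close> with the mass of \<open>{i. M\<^sub>i < K \<and> t < x i}\<close>.  The latter set is independent, because an
edge inside it would give some \<open>M\<^sub>i > t\<close>, so NCOND makes each layer contribute at least a fixed
positive amount (\<open>layer_gap\<close>), and \<open>V\<close> has a drift of order minus the longest queue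
(\<open>quadratic_drift\<close>).

This leaves a finite set of states.  From every state other than \<open>0\<close> the number of unmatched nodes
goes down with a probability bounded below, so \<open>\<theta> ^ (\<Sum>\<^sub>j x j)\<close> at least doubles in mean for small
\<open>\<theta>\<close> (\<open>geometric_growth\<close>).  A large multiple of \<open>1 - \<theta> ^ (\<Sum>\<^sub>j x j)\<close>, which is bounded and has a negative
drift everywhere off \<open>0\<close>, repairs \<open>V\<close> on that finite set (\<open>foster_function\<close>).

\<^bold>\<open>Transience when \<open>\<eta> < 0\<close>.\<close>  Take an independent set \<open>I\<close> that is heavier than its neighbourhood \<open>N\<close> and
let \<open>Z\<close> be the number of unmatched nodes in \<open>I\<close> minus that in \<open>N\<close>.  Whatever the policy does, an
arrival in \<open>I\<close> raises \<open>Z\<close> by \<open>1\<close>, an arrival in \<open>N\<close> lowers it by at most \<open>1\<close>, and any other arrival does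
not lower it.  So \<open>Z\<close> dominates a random walk with positive drift, and for a suitable \<open>\<theta> < 1\<close> the
mean of \<open>\<theta>\<close> to the power \<open>Z\<close> decays geometrically (\<open>excess_contraction\<close>).  Since \<open>Z = 0\<close> at a perfect
matching, the Borel-Cantelli lemma finishes the proof (\<open>markov_chain_transient_if_contraction\<close>).\<close>

section \<open>Drift criteria for Markov chains\<close>

lemma finite_set_trajectory_pmf:
  assumes "\<And>x. finite (set_pmf (K x))"
  shows "finite (set_pmf (trajectory_pmf x0 K t))"
  using assms by (induction t) auto

lemma expectation_trajectory_pmf_Suc:
  fixes F :: "'s list \<Rightarrow> real"
  assumes fin: "\<And>x. finite (set_pmf (K x))"
  shows "measure_pmf.expectation (trajectory_pmf x0 K (Suc t)) F =
    measure_pmf.expectation (trajectory_pmf x0 K t)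
      (\<lambda>h. measure_pmf.expectation (K (last h)) (\<lambda>y. F (h @ [y])))"
proof -
  let ?T = "trajectory_pmf x0 K t"
  have "measure_pmf.expectation (trajectory_pmf x0 K (Suc t)) F =
      (\<Sum>h\<in>set_pmf ?T. pmf ?T h *\<^sub>R measure_pmf.expectation (K (last h)) (\<lambda>y. F (h @ [y])))"
    using finite_set_trajectory_pmf[OF fin] fin
    by (simp add: pmf_expectation_bind[of "set_pmf ?T"])
  also have "\<dots> = measure_pmf.expectation ?T
      (\<lambda>h. measure_pmf.expectation (K (last h)) (\<lambda>y. F (h @ [y])))"
    by (rule integral_measure_pmf[symmetric]) (auto intro: finite_set_trajectory_pmf[OF fin])
  finally show ?thesis .
qed

lemma expectation_mono_finite_pmf:
  fixes f g :: "'s \<Rightarrow> real"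
  assumes "finite (set_pmf p)" "\<And>x. x \<in> set_pmf p \<Longrightarrow> f x \<le> g x"
  shows "measure_pmf.expectation p f \<le> measure_pmf.expectation p g"
  using assms by (intro integral_mono_AE) (auto simp: AE_measure_pmf_iff intro: integrable_measure_pmf_finite)

text \<open>As long as \<open>z\<close> has been avoided, each further step costs one unit of \<open>W\<close>, and only the amount present
at time \<open>s\<close> can be spent.  The sum is the expected time spent avoiding \<open>z\<close> from time \<open>s\<close> on,
truncated after \<open>n\<close> steps.\<close>

lemma occupation_bound:
  fixes W :: "'s \<Rightarrow> real"
  assumes fin: "\<And>x. finite (set_pmf (K x))" and nonneg: "\<And>x. 0 \<le> W x"
    and drift: "\<And>x. x \<noteq> z \<Longrightarrow> measure_pmf.expectation (K x) W \<le> W x - 1"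
  shows "(\<Sum>k<n. measure_pmf.prob (trajectory_pmf x0 K (s + k)) {h. \<forall>u\<in>{s..s + k}. h ! u \<noteq> z})
    \<le> measure_pmf.expectation (trajectory_pmf x0 K s) (\<lambda>h. W (last h))"
proof -
  let ?T = "\<lambda>k. trajectory_pmf x0 K (s + k)"
  define A where "A k = {h. \<forall>u\<in>{s..<s + k}. h ! u \<noteq> z}" for k
  \<comment> \<open>The mass of \<open>W\<close> at time \<open>s + k\<close> on paths whose states at \<open>s, \<dots>, s + k - 1\<close> avoid \<open>z\<close>; the sum to be
    bounded telescopes against its decrements.\<close>
  define a where "a k = measure_pmf.expectation (?T k) (\<lambda>h. indicator (A k) h * W (last h))" for k
  have finT: "finite (set_pmf (?T k))" for k by (rule finite_set_trajectory_pmf[OF fin])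
  have int: "integrable (measure_pmf (?T k)) f" for k and f :: "'s list \<Rightarrow> real"
    by (rule integrable_measure_pmf_finite[OF finT])
  have A_Suc: "A (Suc k) = {h. \<forall>u\<in>{s..s + k}. h ! u \<noteq> z}" for k
    by (simp add: A_def atLeastLessThanSuc_atLeastAtMost)
  have step: "measure_pmf.prob (?T k) (A (Suc k)) \<le> a k - a (Suc k)" for k
  proof -
    have "a (Suc k) = measure_pmf.expectation (?T k) (\<lambda>h. measure_pmf.expectation (K (last h))
        (\<lambda>y. indicator (A (Suc k)) (h @ [y]) * W y))"
      unfolding a_def add_Suc_right by (subst expectation_trajectory_pmf_Suc[OF fin]) simp
    also have "\<dots> \<le> measure_pmf.expectation (?T k)
        (\<lambda>h. indicator (A k) h * W (last h) - indicator (A (Suc k)) h)"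
    proof (rule expectation_mono_finite_pmf[OF finT])
      fix h assume h: "h \<in> set_pmf (?T k)"
      have len: "length h = Suc (s + k)" by (rule trajectory_pmf_length[OF h])
      then have last: "last h = h ! (s + k)" by (simp add: last_conv_nth flip: length_greater_0_conv)
      have ind: "indicator (A (Suc k)) (h @ [y]) = (indicator (A (Suc k)) h :: real)" for y
        using len by (auto simp: A_Suc indicator_def nth_append)
      have sub: "h \<in> A k" if "h \<in> A (Suc k)" using that by (auto simp: A_def)
      have ne: "last h \<noteq> z" if "h \<in> A (Suc k)" using that by (auto simp: A_Suc last)
      show "measure_pmf.expectation (K (last h)) (\<lambda>y. indicator (A (Suc k)) (h @ [y]) * W y)
          \<le> indicator (A k) h * W (last h) - indicator (A (Suc k)) h"
        unfolding ind using drift[of "last h"] ne sub nonneg[of "last h"]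
        by (cases "h \<in> A (Suc k)"; cases "h \<in> A k") auto
    qed
    also have "\<dots> = a k - measure_pmf.prob (?T k) (A (Suc k))"
      unfolding a_def by (subst Bochner_Integration.integral_diff) (auto intro: int)
    finally show ?thesis by simp
  qed
  have "(\<Sum>k<n. measure_pmf.prob (?T k) (A (Suc k))) \<le> (\<Sum>k<n. a k - a (Suc k))"
    by (rule sum_mono) (rule step)
  also have "\<dots> = a 0 - a n" by (rule sum_lessThan_telescope')
  also have "\<dots> \<le> a 0"
    unfolding a_def by (simp add: nonneg Bochner_Integration.integral_nonneg)
  also have "a 0 = measure_pmf.expectation (trajectory_pmf x0 K s) (\<lambda>h. W (last h))"
    by (simp add: a_def A_def)
  finally show ?thesis by (simp only: A_Suc)
qed

text \<open>If \<open>z\<close> were never visited after time \<open>s\<close> with positive probability, the expected time spent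
avoiding \<open>z\<close> after time \<open>s\<close> would be infinite, against \<open>occupation_bound\<close>.  The mean of \<open>W\<close> at
time \<open>s\<close> is finite because only finitely many states are possible then.\<close>

lemma markov_chain_recurrent_if_drift:
  fixes W :: "'s \<Rightarrow> real"
  assumes mc: "markov_chain M X x0 (\<lambda>x. pmf (K x))" and fin: "\<And>x. finite (set_pmf (K x))"
    and nonneg: "\<And>x. 0 \<le> W x"
    and drift: "\<And>x. x \<noteq> z \<Longrightarrow> measure_pmf.expectation (K x) W \<le> W x - 1"
  shows "measure M {\<omega> \<in> space M. \<exists>\<^sub>\<infinity>t. X t \<omega> = z} = 1"
proof -
  interpret prob_space M using mc by (simp add: markov_chain_def)
  have meas [measurable]: "X t \<in> M \<rightarrow>\<^sub>M count_space UNIV" for t using mc by (simp add: markov_chain_def)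
  have never: "prob {\<omega> \<in> space M. \<forall>u\<ge>s. X u \<omega> \<noteq> z} = 0" for s
  proof (rule ccontr)
    let ?p = "prob {\<omega> \<in> space M. \<forall>u\<ge>s. X u \<omega> \<noteq> z}"
    let ?E = "measure_pmf.expectation (trajectory_pmf x0 K s) (\<lambda>h. W (last h))"
    assume "?p \<noteq> 0"
    then have pos: "?p > 0" by (simp add: zero_less_measure_iff)
    have le: "?p \<le> measure_pmf.prob (trajectory_pmf x0 K (s + k)) {h. \<forall>u\<in>{s..s + k}. h ! u \<noteq> z}" for k
    proof -
      let ?A = "{h. \<forall>u\<in>{s..s + k}. h ! u \<noteq> z}"
      have ev: "{\<omega> \<in> space M. map (\<lambda>u. X u \<omega>) [0..<Suc (s + k)] \<in> ?A} =
          {\<omega> \<in> space M. \<forall>u\<in>{s..s + k}. X u \<omega> \<noteq> z}"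
        by (auto simp: less_Suc_eq_le simp del: upt_Suc)
      have "?p \<le> prob {\<omega> \<in> space M. \<forall>u\<in>{s..s + k}. X u \<omega> \<noteq> z}"
        by (rule finite_measure_mono) auto
      also have "\<dots> = measure_pmf.prob (trajectory_pmf x0 K (s + k)) ?A"
        unfolding ev[symmetric] by (rule markov_chain_trajectory[OF mc]) (simp only: ev, measurable)
      finally show ?thesis .
    qed
    obtain n :: nat where n: "?E < real n * ?p" using reals_Archimedean3[OF pos] by blast
    have "real n * ?p \<le> ?E"
      using order_trans[OF sum_mono[of "{..<n}", OF le] occupation_bound[OF fin nonneg drift]] by simp
    then show False using n by simp
  qed
  have "AE \<omega> in M. \<exists>u\<ge>s. X u \<omega> = z" for s
  proof -
    have "AE \<omega> in M. \<not> (\<forall>u\<ge>s. X u \<omega> \<noteq> z)"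
      using never[of s] by (subst (asm) prob_Collect_eq_0) auto
    then show ?thesis by simp
  qed
  then have "AE \<omega> in M. \<forall>s. \<exists>u\<ge>s. X u \<omega> = z" by (simp add: AE_all_countable)
  then show ?thesis unfolding INFM_nat_le by (subst prob_Collect_eq_1) auto
qed

text \<open>By Markov's inequality the probability of being at \<open>z\<close> at time \<open>t\<close> is at most \<open>r ^ t * f x0 / f z\<close>,
which is summable.\<close>

lemma markov_chain_transient_if_contraction:
  fixes f :: "'s \<Rightarrow> real"
  assumes mc: "markov_chain M X x0 (\<lambda>x. pmf (K x))" and fin: "\<And>x. finite (set_pmf (K x))"
    and nonneg: "\<And>x. 0 \<le> f x" and pos: "0 < f z"
    and r: "0 \<le> r" "r < 1"
    and contr: "\<And>x. measure_pmf.expectation (K x) f \<le> r * f x"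
  shows "measure M {\<omega> \<in> space M. \<exists>\<^sub>\<infinity>t. X t \<omega> = z} = 0"
proof -
  interpret prob_space M using mc by (simp add: markov_chain_def)
  have meas [measurable]: "X t \<in> M \<rightarrow>\<^sub>M count_space UNIV" for t using mc by (simp add: markov_chain_def)
  let ?T = "trajectory_pmf x0 K"
  have finT: "finite (set_pmf (?T t))" for t by (rule finite_set_trajectory_pmf[OF fin])
  have decay: "measure_pmf.expectation (?T t) (\<lambda>h. f (last h)) \<le> r ^ t * f x0" for t
  proof (induction t)
    case (Suc t)
    have "measure_pmf.expectation (?T (Suc t)) (\<lambda>h. f (last h)) =
        measure_pmf.expectation (?T t) (\<lambda>h. measure_pmf.expectation (K (last h)) f)"
      by (subst expectation_trajectory_pmf_Suc[OF fin]) simp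
    also have "\<dots> \<le> measure_pmf.expectation (?T t) (\<lambda>h. r * f (last h))"
      by (rule expectation_mono_finite_pmf[OF finT contr])
    also have "\<dots> \<le> r * (r ^ t * f x0)" using Suc r by (simp add: mult_left_mono)
    finally show ?case by (simp add: mult.assoc)
  qed simp
  have bound: "prob {\<omega> \<in> space M. X t \<omega> = z} \<le> r ^ t * f x0 / f z" for t
  proof -
    let ?A = "{h. h ! t = z}"
    have ev: "{\<omega> \<in> space M. map (\<lambda>u. X u \<omega>) [0..<Suc t] \<in> ?A} = {\<omega> \<in> space M. X t \<omega> = z}"
      by (auto simp del: upt_Suc)
    have "prob {\<omega> \<in> space M. X t \<omega> = z} = measure_pmf.prob (?T t) ?A"
      unfolding ev[symmetric] by (rule markov_chain_trajectory[OF mc]) (simp only: ev, measurable)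
    also have "\<dots> = measure_pmf.expectation (?T t) (indicator ?A)" by simp
    also have "\<dots> \<le> measure_pmf.expectation (?T t) (\<lambda>h. f (last h) / f z)"
    proof (rule expectation_mono_finite_pmf[OF finT])
      fix h assume "h \<in> set_pmf (?T t)"
      then have "length h = Suc t" by (rule trajectory_pmf_length)
      then have "last h = h ! t" by (simp add: last_conv_nth flip: length_greater_0_conv)
      then show "indicator ?A h \<le> f (last h) / f z"
        using pos nonneg[of "last h"] by (auto simp: indicator_def)
    qed
    also have "\<dots> \<le> r ^ t * f x0 / f z" using decay[of t] pos by (simp add: divide_right_mono)
    finally show ?thesis .
  qed
  have "summable (\<lambda>t. prob {\<omega> \<in> space M. X t \<omega> = z})"
  proof (rule summable_comparison_test')
    show "summable (\<lambda>t. r ^ t * (f x0 / f z))"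
      using r by (intro summable_mult2 summable_geometric) simp
    show "norm (prob {\<omega> \<in> space M. X t \<omega> = z}) \<le> r ^ t * (f x0 / f z)" for t
      using bound[of t] by simp
  qed
  then have "AE \<omega> in M. eventually (\<lambda>t. \<omega> \<in> space M - {\<omega> \<in> space M. X t \<omega> = z}) sequentially"
    by (intro borel_cantelli_AE1) (auto simp: emeasure_eq_measure)
  then have "AE \<omega> in M. \<not> (\<exists>\<^sub>\<infinity>t. X t \<omega> = z)"
    by eventually_elim (simp add: cofinite_eq_sequentially not_frequently, erule eventually_mono, simp)
  then show ?thesis unfolding INFM_nat_le by (subst prob_Collect_eq_0) auto
qed



section \<open>Auxiliary sums and inequalities\<close>

lemma sum_fun_upd:
  fixes g :: "'b \<Rightarrow> 'r::ab_group_add"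
  assumes "finite A"
  shows "(\<Sum>j\<in>A. g ((x(i := v)) j)) = (\<Sum>j\<in>A. g (x j)) + (if i \<in> A then g v - g (x i) else 0)"
proof (cases "i \<in> A")
  case True
  have "(\<Sum>j\<in>A - {i}. g ((x(i := v)) j)) = (\<Sum>j\<in>A - {i}. g (x j))" by (rule sum.cong) auto
  then show ?thesis using True by (simp add: sum.remove[OF assms True])
next
  case False
  then have "(\<Sum>j\<in>A. g ((x(i := v)) j)) = (\<Sum>j\<in>A. g (x j))" by (intro sum.cong) auto
  then show ?thesis using False by simp
qed

lemma sum_UNIV_pmf [simp]: "(\<Sum>i\<in>UNIV. pmf p i) = (1::real)" for p :: "'a::finite pmf"
  by (rule sum_pmf_eq_1) auto

lemma sum_pmf_of_bool:
  fixes p :: "'a::finite pmf"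
  shows "(\<Sum>i\<in>UNIV. pmf p i * of_bool (i \<in> A)) = (\<Sum>i\<in>A. pmf p i)"
  by (rule sum.mono_neutral_cong_right) auto

lemma sum_pmf_diff_const:
  fixes p :: "'a::finite pmf"
  shows "(\<Sum>i\<in>UNIV. pmf p i * (f i - c)) = (\<Sum>i\<in>UNIV. pmf p i * f i) - c"
  by (simp add: right_diff_distrib sum_subtractf flip: sum_distrib_right)

lemma sum_pmf_const_diff:
  fixes p :: "'a::finite pmf"
  shows "(\<Sum>i\<in>UNIV. pmf p i * (c - a * f i)) = c - a * (\<Sum>i\<in>UNIV. pmf p i * f i)"
proof -
  have "(\<Sum>i\<in>UNIV. pmf p i * (c - a * f i)) = (\<Sum>i\<in>UNIV. pmf p i) * c - a * (\<Sum>i\<in>UNIV. pmf p i * f i)"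
    unfolding sum_distrib_left sum_distrib_right sum_subtractf[symmetric]
    by (rule sum.cong) (auto simp: algebra_simps)
  then show ?thesis by simp
qed

text \<open>The layer-cake decomposition of the part of \<open>a\<close> above \<open>K\<close>; the bound \<open>T\<close> lets different \<open>a\<close> share one
range of levels.\<close>

lemma of_nat_diff_eq_layers:
  "a \<le> T \<Longrightarrow> real (a - K) = (\<Sum>t\<in>{K..<T}. of_bool (t < a))"
proof -
  assume "a \<le> T"
  then have "{K..<T} \<inter> {t. t < a} = {K..<a}" by auto
  then show ?thesis by (simp add: of_bool_def sum.If_cases)
qed

text \<open>There are finitely many classes and \<open>\<alpha>\<close> breaks every tie, so the lexicographic maximum exists and is
unique.\<close>

lemma policy_greatest:
  fixes \<alpha> :: "'c::finite \<Rightarrow> nat"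
  assumes inj: "inj \<alpha>"
  shows "w (x k) (\<rho> i k) \<le> w (x (policy w \<rho> \<alpha> x i)) (\<rho> i (policy w \<rho> \<alpha> x i))"
proof -
  define v where "v j = w (x j) (\<rho> i j)" for j
  let ?best = "\<lambda>j. \<forall>k. v k < v j \<or> v k = v j \<and> \<alpha> k \<le> \<alpha> j"
  define J where "J = {j. v j = Max (range v)}"
  have "Max (range v) \<in> range v" by (rule Max_in) auto
  then have "J \<noteq> {}" unfolding J_def by (metis (mono_tags) empty_Collect_eq imageE)
  then have "Max (\<alpha> ` J) \<in> \<alpha> ` J" by (intro Max_in) auto
  then obtain j where j: "j \<in> J" "\<alpha> j = Max (\<alpha> ` J)" by auto
  have best: "?best j"
  proof
    fix k
    have le: "v k \<le> v j" using j(1) by (simp add: J_def)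
    have "\<alpha> k \<le> \<alpha> j" if "v k = v j"
    proof -
      have "k \<in> J" using that j(1) by (simp add: J_def)
      then show ?thesis by (simp add: j(2))
    qed
    with le show "v k < v j \<or> v k = v j \<and> \<alpha> k \<le> \<alpha> j" by fastforce
  qed
  have "l = j" if "?best l" for l
    using that[THEN spec, of j] best[THEN spec, of l] injD[OF inj, of l j] by fastforce
  then have "policy w \<rho> \<alpha> x i = j"
    unfolding policy_def v_def[symmetric] using best by (intro the_equality)
  then show ?thesis using best[THEN spec, of k] by (auto simp: v_def)
qed

text \<open>Bernoulli's inequality for \<open>(1 + r) ^ n\<close> turns the geometric decay of \<open>(1 - r) ^ n\<close> into a bound that
controls both \<open>(1 - r) ^ n\<close> and \<open>n * (1 - r) ^ n\<close>.\<close>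

lemma power_one_minus_le:
  fixes r :: real
  assumes "0 \<le> r" "r \<le> 1"
  shows "(1 - r) ^ n * (1 + real n * r) \<le> 1"
proof -
  have "(1 - r) ^ n * (1 + real n * r) \<le> (1 - r) ^ n * (1 + r) ^ n"
    using assms by (intro mult_left_mono Bernoulli_inequality) auto
  also have "\<dots> = (1 - r\<^sup>2) ^ n"
    by (simp add: power_mult_distrib[symmetric] power2_eq_square algebra_simps)
  also have "\<dots> \<le> 1" using assms by (intro power_le_one) (auto simp: power_le_one)
  finally show ?thesis .
qed

section \<open>The chain of unmatched nodes as a kernel\<close>

locale block_model_matching =
  fixes \<nu> :: "'c::finite pmf" and \<rho> :: "'c \<Rightarrow> 'c \<Rightarrow> real"
    and w :: "nat \<Rightarrow> real \<Rightarrow> real" and \<alpha> :: "'c \<Rightarrow> nat"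
  assumes class_pos: "pmf \<nu> i > 0"
    and prob_range: "\<rho> i j \<in> {0..1}"
    and prob_sym: "\<rho> i j = \<rho> j i"
    and weight: "weight_function w"
    and tie_inj: "inj \<alpha>"
begin

abbreviation \<phi> :: "('c \<Rightarrow> nat) \<Rightarrow> 'c \<Rightarrow> 'c" where
  "\<phi> \<equiv> policy w \<rho> \<alpha>"

text \<open>The probability that an arriving node of class \<open>i\<close> has no edge to the waiting nodes of the class picked
by the policy; an empty queue gives \<open>1\<close>, also when the edge probability is \<open>1\<close>.\<close>

definition miss :: "('c \<Rightarrow> nat) \<Rightarrow> 'c \<Rightarrow> real" where
  "miss x i = (1 - \<rho> i (\<phi> x i)) ^ x (\<phi> x i)"

definition step_pmf :: "('c \<Rightarrow> nat) \<Rightarrow> ('c \<Rightarrow> nat) pmf" where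
  "step_pmf x = bind_pmf \<nu> (\<lambda>i. map_pmf
     (\<lambda>b. if b then x(i := x i + 1) else x(\<phi> x i := x (\<phi> x i) - 1)) (bernoulli_pmf (miss x i)))"

lemma miss_bounds: "0 \<le> miss x i" "miss x i \<le> 1"
  using prob_range[of i "\<phi> x i"] by (auto simp: miss_def power_le_one)

text \<open>So the matching move, which truncates at \<open>0\<close>, is taken with positive probability only where it is a
genuine decrement along an edge.\<close>

lemma miss_eq_1: "\<not> (x (\<phi> x i) > 0 \<and> \<rho> i (\<phi> x i) > 0) \<Longrightarrow> miss x i = 1"
  using prob_range[of i "\<phi> x i"] by (cases "\<rho> i (\<phi> x i) = 0") (auto simp: miss_def)

lemma finite_set_step_pmf: "finite (set_pmf (step_pmf x))"
  by (auto simp: step_pmf_def)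

lemma expectation_step_pmf:
  fixes f :: "('c \<Rightarrow> nat) \<Rightarrow> real"
  shows "measure_pmf.expectation (step_pmf x) f = (\<Sum>i\<in>UNIV. pmf \<nu> i *
    (miss x i * f (x(i := x i + 1)) + (1 - miss x i) * f (x(\<phi> x i := x (\<phi> x i) - 1))))"
  unfolding step_pmf_def
  by (subst pmf_expectation_bind[of UNIV]) (auto simp: miss_bounds mult.commute)

lemma transition_eq_pmf_step: "transition \<nu> \<rho> w \<alpha> x = pmf (step_pmf x)"
proof
  fix y
  have "pmf (step_pmf x) y = measure_pmf.expectation (step_pmf x) (indicator {y})"
    by (simp add: measure_pmf_single)
  also have "\<dots> = (\<Sum>i\<in>UNIV. (if y = x(i := x i + 1) then pmf \<nu> i * miss x i else 0) +
      (if x (\<phi> x i) > 0 \<and> y = x(\<phi> x i := x (\<phi> x i) - 1) then pmf \<nu> i * (1 - miss x i) else 0))"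
    unfolding expectation_step_pmf
  proof (rule sum.cong[OF refl])
    fix i
    show "pmf \<nu> i * (miss x i * indicator {y} (x(i := x i + 1)) +
        (1 - miss x i) * indicator {y} (x(\<phi> x i := x (\<phi> x i) - 1))) =
      (if y = x(i := x i + 1) then pmf \<nu> i * miss x i else 0) +
      (if x (\<phi> x i) > 0 \<and> y = x(\<phi> x i := x (\<phi> x i) - 1) then pmf \<nu> i * (1 - miss x i) else 0)"
      using miss_eq_1[of x i] by (simp add: indicator_def algebra_simps eq_commute[of y])
  qed
  also have "\<dots> = (\<Sum>i\<in>UNIV. if y = x(i := x i + 1) then pmf \<nu> i * miss x i else 0) +
      (\<Sum>i\<in>UNIV. if x (\<phi> x i) > 0 \<and> y = x(\<phi> x i := x (\<phi> x i) - 1)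
        then pmf \<nu> i * (1 - miss x i) else 0)"
    by (rule sum.distrib)
  also have "(\<Sum>i\<in>UNIV. if x (\<phi> x i) > 0 \<and> y = x(\<phi> x i := x (\<phi> x i) - 1)
        then pmf \<nu> i * (1 - miss x i) else 0) =
      (\<Sum>j\<in>UNIV. \<Sum>i | \<phi> x i = j. if x (\<phi> x i) > 0 \<and> y = x(\<phi> x i := x (\<phi> x i) - 1)
        then pmf \<nu> i * (1 - miss x i) else 0)"
    by (rule sum.group[of UNIV UNIV "\<phi> x", simplified UNIV_I simp_thms, symmetric]) auto
  also have "\<dots> = (\<Sum>j\<in>UNIV. if x j > 0 \<and> y = x(j := x j - 1)
        then \<Sum>i | \<phi> x i = j. pmf \<nu> i * (1 - (1 - \<rho> i j) ^ x j) else 0)"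
    by (intro sum.cong) (auto simp: miss_def intro!: sum.neutral)
  finally show "transition \<nu> \<rho> w \<alpha> x y = pmf (step_pmf x) y"
    by (simp only: transition_def miss_def)
qed

section \<open>Transience when some independent set outweighs its neighbourhood\<close>

definition excess :: "'c set \<Rightarrow> ('c \<Rightarrow> nat) \<Rightarrow> real" where
  "excess I x = (\<Sum>i\<in>I. real (x i)) - (\<Sum>j\<in>root_nbhd \<rho> I. real (x j))"

lemma excess_arrival:
  "excess I (x(i := x i + 1)) = excess I x + of_bool (i \<in> I) - of_bool (i \<in> root_nbhd \<rho> I)"
  by (simp add: excess_def sum_fun_upd del: fun_upd_apply)

text \<open>A matched arrival changes the excess at least as favourably as an unmatched one of the same class.
The partner's class \<open>j\<close> is adjacent to \<open>i\<close>: if \<open>i \<in> I\<close>, a node of the neighbourhood is consumed, and a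
node of \<open>I\<close> is consumed only by an arrival in the neighbourhood.\<close>

lemma excess_match:
  assumes I: "root_independent \<rho> I" and hit: "x (\<phi> x i) > 0" "\<rho> i (\<phi> x i) > 0"
  shows "excess I x + of_bool (i \<in> I) - of_bool (i \<in> root_nbhd \<rho> I)
    \<le> excess I (x(\<phi> x i := x (\<phi> x i) - 1))"
proof -
  let ?j = "\<phi> x i"
  have disj: "j \<notin> root_nbhd \<rho> I" if "j \<in> I" for j
    using I that by (auto simp: root_independent_def root_nbhd_def)
  have fwd: "?j \<in> root_nbhd \<rho> I" if "i \<in> I"
    using that hit by (auto simp: root_nbhd_def root_edge_def)
  have bwd: "i \<in> root_nbhd \<rho> I" if "?j \<in> I"
    using that hit prob_sym[of i ?j] by (auto simp: root_nbhd_def root_edge_def intro!: bexI[of _ ?j])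
  have "excess I (x(?j := x ?j - 1)) =
      excess I x - of_bool (?j \<in> I) + of_bool (?j \<in> root_nbhd \<rho> I)"
    using hit by (simp add: excess_def sum_fun_upd of_nat_diff del: fun_upd_apply)
  then show ?thesis using disj[of i] disj[of ?j] fwd bwd by auto
qed

text \<open>With \<open>a\<close> and \<open>b\<close> the masses of \<open>I\<close> and its neighbourhood, the random walk below the excess has
\<open>r = 1 + a (\<theta> - 1) + b (1/\<theta> - 1)\<close> as the mean of \<open>\<theta>\<close> to the power of its increment, and \<open>r < 1\<close> holds
exactly for \<open>b/a < \<theta> < 1\<close>.\<close>

lemma excess_contraction:
  assumes I: "root_independent \<rho> I"
    and deficit: "(\<Sum>j\<in>root_nbhd \<rho> I. pmf \<nu> j) < (\<Sum>i\<in>I. pmf \<nu> i)"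
  obtains \<theta> r where "0 < \<theta>" "0 \<le> r" "r < 1"
    "\<And>x. measure_pmf.expectation (step_pmf x) (\<lambda>y. \<theta> powr excess I y) \<le> r * \<theta> powr excess I x"
proof -
  let ?N = "root_nbhd \<rho> I"
  define a b where "a = (\<Sum>i\<in>I. pmf \<nu> i)" and "b = (\<Sum>j\<in>?N. pmf \<nu> j)"
  have ab: "0 \<le> b" "b < a" using deficit by (auto simp: a_def b_def sum_nonneg)
  \<comment> \<open>The midpoint of the interval from \<open>b/a\<close> to \<open>1\<close>.\<close>
  define \<theta> where "\<theta> = (a + b) / (2 * a)"
  have \<theta>: "0 < \<theta>" "\<theta> < 1" "b < a * \<theta>" using ab by (auto simp: \<theta>_def field_simps)
  define D :: "'c \<Rightarrow> real" where "D i = of_bool (i \<in> I) - of_bool (i \<in> ?N)" for i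
  define r where "r = (\<Sum>i\<in>UNIV. pmf \<nu> i * \<theta> powr D i)"
  have disj: "i \<notin> ?N" if "i \<in> I" for i
    using I that by (auto simp: root_independent_def root_nbhd_def)
  have "\<theta> powr D i = 1 + of_bool (i \<in> I) * (\<theta> - 1) + of_bool (i \<in> ?N) * (1 / \<theta> - 1)" for i
    using disj[of i] \<theta> by (auto simp: D_def powr_minus_divide)
  then have "r = (\<Sum>i\<in>UNIV. pmf \<nu> i + pmf \<nu> i * of_bool (i \<in> I) * (\<theta> - 1) +
      pmf \<nu> i * of_bool (i \<in> ?N) * (1 / \<theta> - 1))"
    by (simp only: r_def) (simp add: algebra_simps)
  also have "\<dots> = 1 + a * (\<theta> - 1) + b * (1 / \<theta> - 1)"
    by (simp only: sum.distrib sum_distrib_right[symmetric] sum_pmf_of_bool sum_UNIV_pmf a_def b_def)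
  also have "\<dots> = 1 - (1 - \<theta>) * (a * \<theta> - b) / \<theta>"
    using \<theta> by (simp add: field_simps)
  also have "\<dots> < 1" using \<theta> by (simp add: divide_pos_pos)
  finally have r1: "r < 1" .
  have mono: "\<theta> powr excess I y \<le> \<theta> powr D i * \<theta> powr excess I x"
    if "excess I x + D i \<le> excess I y" for x y i
  proof -
    have "\<theta> powr excess I y \<le> \<theta> powr (D i + excess I x)"
      using that \<theta> by (intro powr_mono') auto
    then show ?thesis by (simp add: powr_add)
  qed
  have contr: "measure_pmf.expectation (step_pmf x) (\<lambda>y. \<theta> powr excess I y)
      \<le> r * \<theta> powr excess I x" for x
    unfolding expectation_step_pmf r_def sum_distrib_right mult.assoc
  proof (intro sum_mono mult_left_mono)
    fix i
    let ?b = "\<theta> powr D i * \<theta> powr excess I x"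
    have up: "\<theta> powr excess I (x(i := x i + 1)) \<le> ?b"
      by (rule mono) (unfold excess_arrival D_def, simp)
    have down: "(1 - miss x i) * \<theta> powr excess I (x(\<phi> x i := x (\<phi> x i) - 1)) \<le> (1 - miss x i) * ?b"
    proof (cases "x (\<phi> x i) > 0 \<and> \<rho> i (\<phi> x i) > 0")
      case True
      then show ?thesis using excess_match[OF I, of x i] miss_bounds[of x i]
        by (intro mult_left_mono mono) (auto simp: D_def simp del: fun_upd_apply)
    qed (simp add: miss_eq_1)
    have "miss x i * \<theta> powr excess I (x(i := x i + 1)) \<le> miss x i * ?b"
      by (rule mult_left_mono[OF up miss_bounds(1)])
    with down show "miss x i * \<theta> powr excess I (x(i := x i + 1)) +
        (1 - miss x i) * \<theta> powr excess I (x(\<phi> x i := x (\<phi> x i) - 1)) \<le> ?b"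
      by (simp add: left_diff_distrib)
  qed simp
  have "0 \<le> r" by (simp add: r_def sum_nonneg)
  from that[OF \<theta>(1) this r1 contr] show ?thesis .
qed


section \<open>The policy favours the longest neighbouring queue\<close>

lemma edge_prob_lower_bound:
  obtains r where "0 < r" "r \<le> 1" "\<And>i j. \<rho> i j > 0 \<Longrightarrow> r \<le> \<rho> i j"
proof
  define R where "R = insert 1 ((\<lambda>(i, j). \<rho> i j) ` {(i, j). \<rho> i j > 0})"
  have fin: "finite R" by (simp add: R_def)
  have "Min R \<in> R" by (rule Min_in[OF fin]) (simp add: R_def)
  then show "0 < Min R" by (auto simp: R_def)
  show "Min R \<le> 1" by (rule Min_le[OF fin]) (simp add: R_def)
  show "Min R \<le> \<rho> i j" if "\<rho> i j > 0" for i j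
    by (rule Min_le[OF fin]) (use that in \<open>auto simp: R_def\<close>)
qed

lemma class_prob_lower_bound:
  obtains p where "0 < p" "p \<le> 1" "\<And>i. p \<le> pmf \<nu> i"
proof
  have "Min (range (pmf \<nu>)) \<in> range (pmf \<nu>)" by (rule Min_in) auto
  then obtain i where i: "Min (range (pmf \<nu>)) = pmf \<nu> i" by (rule rangeE)
  show "0 < Min (range (pmf \<nu>))" "Min (range (pmf \<nu>)) \<le> 1"
    unfolding i using class_pos pmf_le_1 by auto
  show "Min (range (pmf \<nu>)) \<le> pmf \<nu> i" for i by (rule Min_le) auto
qed

text \<open>A class has positive weight exactly if it has waiting nodes that the arrival may connect to,
so the policy picks such a class whenever there is one.\<close>

lemma policy_useful:
  assumes "\<rho> i k > 0" "x k > 0"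
  shows "\<rho> i (\<phi> x i) > 0" "x (\<phi> x i) > 0"
proof -
  have pos: "w n (\<rho> i j) > 0 \<longleftrightarrow> n > 0 \<and> \<rho> i j > 0" for n j
    using weight prob_range[of i j] by (auto simp: weight_function_def)
  have "w (x k) (\<rho> i k) > 0" using assms pos by simp
  then have "w (x (\<phi> x i)) (\<rho> i (\<phi> x i)) > 0"
    using policy_greatest[OF tie_inj, where x=x and k=k and i=i and w=w and \<rho>=\<rho>] by linarith
  then show "\<rho> i (\<phi> x i) > 0" "x (\<phi> x i) > 0" using pos by auto
qed

text \<open>For long queues one extra node outweighs any difference between the positive edge
probabilities.  Finiteness of the class set makes the threshold uniform.\<close>

lemma policy_longest_queue:
  obtains m where "\<And>x i k. \<rho> i k > 0 \<Longrightarrow> m \<le> x k \<Longrightarrow> x k \<le> x (\<phi> x i)"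
proof -
  have "\<exists>m. \<forall>n\<ge>m. w (n - 1) 1 < w n (\<rho> i k)" if "\<rho> i k > 0" for i k
  proof -
    have r: "\<rho> i k \<in> {0<..1}" using that prob_range[of i k] by simp
    have "\<forall>r\<in>{0<..1}. \<exists>m\<ge>1. \<forall>n\<ge>m. w (n - 1) 1 < w n r \<and> w n 1 < w (n + 1) r"
      using weight unfolding weight_function_def by (elim conjE)
    from bspec[OF this r] show ?thesis by blast
  qed
  then obtain f where f: "\<And>i k n. \<rho> i k > 0 \<Longrightarrow> f i k \<le> n \<Longrightarrow> w (n - 1) 1 < w n (\<rho> i k)" by metis
  define m where "m = Max (range (\<lambda>(i, k). f i k))"
  have m: "f i k \<le> m" for i k unfolding m_def by (rule Max_ge) (auto intro!: image_eqI[of _ _ "(i, k)"])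
  have w_mono1: "n \<le> n' \<Longrightarrow> 0 \<le> r \<Longrightarrow> r \<le> 1 \<Longrightarrow> w n r \<le> w n' r"
    and w_mono2: "0 \<le> r \<Longrightarrow> r \<le> r' \<Longrightarrow> r' \<le> 1 \<Longrightarrow> w n r \<le> w n r'" for n n' r r'
    using weight by (auto simp: weight_function_def)
  have "x k \<le> x (\<phi> x i)" if k: "\<rho> i k > 0" "m \<le> x k" for x i k
  proof (rule ccontr)
    let ?j = "\<phi> x i"
    assume "\<not> x k \<le> x ?j"
    then have "w (x ?j) (\<rho> i ?j) \<le> w (x k - 1) (\<rho> i ?j)"
      using prob_range[of i ?j] by (intro w_mono1) auto
    also have "\<dots> \<le> w (x k - 1) 1" using prob_range[of i ?j] by (intro w_mono2) auto
    also have "\<dots> < w (x k) (\<rho> i k)" using f[OF k(1)] m[of i k] k(2) by auto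
    also have "\<dots> \<le> w (x ?j) (\<rho> i ?j)" by (rule policy_greatest[OF tie_inj])
    finally show False by simp
  qed
  then show ?thesis by (rule that)
qed

lemma miss_le:
  assumes "0 \<le> r" "r \<le> 1" "r \<le> \<rho> i (\<phi> x i)"
  shows "miss x i * (1 + real (x (\<phi> x i)) * r) \<le> 1"
proof -
  have "miss x i \<le> (1 - r) ^ x (\<phi> x i)"
    unfolding miss_def using assms prob_range[of i "\<phi> x i"] by (intro power_mono) auto
  then have "miss x i * (1 + real (x (\<phi> x i)) * r) \<le>
      (1 - r) ^ x (\<phi> x i) * (1 + real (x (\<phi> x i)) * r)"
    using assms by (intro mult_right_mono) auto
  also have "\<dots> \<le> 1" by (rule power_one_minus_le[OF assms(1,2)])
  finally show ?thesis .
qed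

text \<open>The longest queue among the neighbours of \<open>i\<close>; the inserted \<open>0\<close> gives the value for a class without
neighbours.\<close>

definition nbr_max :: "('c \<Rightarrow> nat) \<Rightarrow> 'c \<Rightarrow> nat" where
  "nbr_max x i = Max (insert 0 (x ` {k. \<rho> i k > 0}))"

lemma nbr_max_ge: "\<rho> i k > 0 \<Longrightarrow> x k \<le> nbr_max x i"
  by (simp add: nbr_max_def)

lemma nbr_max_attained:
  assumes "nbr_max x i > 0"
  obtains k where "\<rho> i k > 0" "x k = nbr_max x i"
proof -
  have "nbr_max x i \<in> insert 0 (x ` {k. \<rho> i k > 0})"
    unfolding nbr_max_def by (rule Max_in) auto
  with assms that show ?thesis by auto
qed

lemma nbr_max_le: "nbr_max x i \<le> Max (range x)"
  by (auto simp: nbr_max_def)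

end

section \<open>Recurrence under NCOND\<close>

locale ncond_matching = block_model_matching \<nu> \<rho> w \<alpha>
  for \<nu> :: "'c::finite pmf" and \<rho> w \<alpha> +
  fixes \<epsilon> :: real
  assumes gap_pos: "0 < \<epsilon>"
    and gap: "I \<noteq> {} \<Longrightarrow> root_independent \<rho> I \<Longrightarrow>
      (\<Sum>i\<in>I. pmf \<nu> i) + \<epsilon> \<le> (\<Sum>j\<in>root_nbhd \<rho> I. pmf \<nu> j)"
begin

text \<open>An isolated class would be an independent set with empty neighbourhood, which NCOND forbids.\<close>

lemma has_neighbour: obtains i where "\<rho> i k > 0"
proof (cases "\<exists>i. \<rho> k i > 0")
  case True
  then show ?thesis using that prob_sym[of k] by auto
next
  case False
  then have "root_independent \<rho> {k}" "root_nbhd \<rho> {k} = {}"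
    by (auto simp: root_independent_def root_nbhd_def root_edge_def)
  then show ?thesis using gap[of "{k}"] gap_pos class_pos[of k] by simp
qed

text \<open>One horizontal layer.  The classes with \<open>nbr_max x i < K\<close> and \<open>t < x i\<close> form an independent set whose
neighbours all see a queue longer than \<open>t\<close>; if the set is not empty, NCOND compares the two masses.  If
it is empty, nothing is to be compensated, and a neighbour of the longest queue contributes at
least \<open>p\<close>.\<close>

lemma layer_gap:
  assumes p: "\<And>i. p \<le> pmf \<nu> i" and t: "K \<le> t" "t < Max (range x)"
  shows "min \<epsilon> p \<le> (\<Sum>i\<in>UNIV. pmf \<nu> i *
    (of_bool (t < nbr_max x i) - of_bool (nbr_max x i < K \<and> t < x i)))"
proof -
  define I where "I = {i. nbr_max x i < K \<and> t < x i}"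
  define U where "U = {i. t < nbr_max x i}"
  have "(\<Sum>i\<in>UNIV. pmf \<nu> i * (of_bool (t < nbr_max x i) - of_bool (nbr_max x i < K \<and> t < x i))) =
      (\<Sum>i\<in>UNIV. pmf \<nu> i * of_bool (i \<in> U)) - (\<Sum>i\<in>UNIV. pmf \<nu> i * of_bool (i \<in> I))"
    by (simp only: I_def U_def mem_Collect_eq right_diff_distrib sum_subtractf)
  also have "\<dots> = (\<Sum>i\<in>U. pmf \<nu> i) - (\<Sum>i\<in>I. pmf \<nu> i)" by (simp only: sum_pmf_of_bool)
  finally have eq: "(\<Sum>i\<in>UNIV. pmf \<nu> i * (of_bool (t < nbr_max x i) -
      of_bool (nbr_max x i < K \<and> t < x i))) = (\<Sum>i\<in>U. pmf \<nu> i) - (\<Sum>i\<in>I. pmf \<nu> i)" .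
  show ?thesis
  proof (cases "I = {}")
    case True
    have "Max (range x) \<in> range x" by (rule Max_in) auto
    then obtain k where k: "Max (range x) = x k" by (rule rangeE)
    obtain i where i: "\<rho> i k > 0" by (rule has_neighbour)
    then have "i \<in> U" using nbr_max_ge[OF i, of x] t k by (simp add: U_def)
    then have "pmf \<nu> i \<le> (\<Sum>i\<in>U. pmf \<nu> i)" by (intro member_le_sum) auto
    then show ?thesis unfolding eq using True p[of i] by simp
  next
    case False
    have "\<not> \<rho> i j > 0" if "i \<in> I" "j \<in> I" for i j
      using that nbr_max_ge[of i j x] t by (auto simp: I_def)
    then have "root_independent \<rho> I" by (simp add: root_independent_def root_edge_def)
    from gap[OF False this] have "(\<Sum>i\<in>I. pmf \<nu> i) + \<epsilon> \<le> (\<Sum>j\<in>root_nbhd \<rho> I. pmf \<nu> j)" .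
    also have "\<dots> \<le> (\<Sum>i\<in>U. pmf \<nu> i)"
    proof (rule sum_mono2)
      show "root_nbhd \<rho> I \<subseteq> U"
      proof
        fix j assume "j \<in> root_nbhd \<rho> I"
        then obtain i where "i \<in> I" "\<rho> j i > 0"
          using prob_sym by (auto simp: root_nbhd_def root_edge_def)
        then show "j \<in> U" using nbr_max_ge[of j i x] by (simp add: I_def U_def)
      qed
    qed auto
    finally show ?thesis unfolding eq by simp
  qed
qed

text \<open>Each level from \<open>K\<close> to below the longest queue contributes the gain of \<open>layer_gap\<close>.\<close>

lemma static_gap:
  assumes p: "\<And>i. p \<le> pmf \<nu> i"
  shows "min \<epsilon> p * real (Max (range x) - K) \<le> (\<Sum>i\<in>UNIV. pmf \<nu> i *
    (real (nbr_max x i - K) - (if nbr_max x i < K then real (x i - K) else 0)))"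
proof -
  let ?T = "Max (range x)"
  have x_le: "x i \<le> ?T" for i by simp
  have "real (nbr_max x i - K) - (if nbr_max x i < K then real (x i - K) else 0) =
      (\<Sum>t\<in>{K..<?T}. of_bool (t < nbr_max x i) - of_bool (nbr_max x i < K \<and> t < x i))" for i
    unfolding of_nat_diff_eq_layers[OF nbr_max_le] of_nat_diff_eq_layers[OF x_le]
    by (simp add: sum_subtractf)
  then have "(\<Sum>i\<in>UNIV. pmf \<nu> i *
      (real (nbr_max x i - K) - (if nbr_max x i < K then real (x i - K) else 0))) =
      (\<Sum>t\<in>{K..<?T}. \<Sum>i\<in>UNIV. pmf \<nu> i *
        (of_bool (t < nbr_max x i) - of_bool (nbr_max x i < K \<and> t < x i)))"
    by (simp only: sum_distrib_left) (rule sum.swap)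
  moreover have "(\<Sum>t\<in>{K..<?T}. min \<epsilon> p) \<le> \<dots>"
    by (intro sum_mono layer_gap[OF p]) auto
  ultimately show ?thesis by (simp add: mult.commute)
qed

text \<open>The mean change of the sum of squares is \<open>1 - 2 \<Sum>\<^sub>i \<nu>(i) d\<^sub>i\<close> with
\<open>d\<^sub>i = (1 - miss x i) x(\<phi> x i) - miss x i * x i\<close>.  Each \<open>d\<^sub>i\<close> is at least the summand of \<open>static_gap\<close>, up
to a constant and an error of half the guaranteed gain: if some neighbouring queue reaches \<open>K\<close>, the
arrival is missed with probability at most \<open>e / 2\<close> and the match takes place in a longest
neighbouring queue; otherwise \<open>d\<^sub>i \<ge> - x i\<close>, which is what \<open>static_gap\<close> allows for.\<close>

lemma quadratic_drift:
  obtains C e where "0 < e" "\<And>x. measure_pmf.expectation (step_pmf x) (\<lambda>y. \<Sum>j\<in>UNIV. (real (y j))\<^sup>2)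
    \<le> (\<Sum>j\<in>UNIV. (real (x j))\<^sup>2) + C - e * real (Max (range x))"
proof -
  obtain r where r: "0 < r" "r \<le> 1" "\<And>i j. \<rho> i j > 0 \<Longrightarrow> r \<le> \<rho> i j" using edge_prob_lower_bound by blast
  obtain p where p: "0 < p" "p \<le> 1" "\<And>i. p \<le> pmf \<nu> i" using class_prob_lower_bound by blast
  obtain m where m: "\<And>x i k. \<rho> i k > 0 \<Longrightarrow> m \<le> x k \<Longrightarrow> x k \<le> x (\<phi> x i)" using policy_longest_queue by blast
  define e where "e = min \<epsilon> p"
  have e: "0 < e" using gap_pos p by (simp add: e_def)
  \<comment> \<open>\<open>K0\<close> makes the miss probability at most \<open>e / 2\<close>; \<open>K \<ge> m\<close> puts the policy in its longest-queue regime,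
    and \<open>K \<ge> 1\<close> makes the longest neighbouring queue that of an actual neighbour.\<close>
  obtain K0 :: nat where "1 / (e / 2 * r) < real K0" using reals_Archimedean2 by blast
  then have K0: "1 \<le> e / 2 * (real K0 * r)" using e r by (simp add: field_simps)
  define K where "K = max (max 1 m) K0"
  have K: "1 \<le> K" "m \<le> K" "K0 \<le> K" by (auto simp: K_def)
  define C0 where "C0 = 1 / r + real K"
  have C0: "real K \<le> C0" "1 / r \<le> C0" using r by (auto simp: C0_def)
  have pointwise: "real (nbr_max x i - K) - (if nbr_max x i < K then real (x i - K) else 0)
      - (C0 + e / 2 * real (Max (range x)))
      \<le> (1 - miss x i) * real (x (\<phi> x i)) - miss x i * real (x i)" for x i
  proof (cases "nbr_max x i < K")
    case True
    have "miss x i * real (x i) \<le> 1 * real (x i)" using miss_bounds[of x i] by (intro mult_right_mono) auto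
    moreover have "0 \<le> (1 - miss x i) * real (x (\<phi> x i))" using miss_bounds[of x i] by simp
    moreover have "0 \<le> e / 2 * real (Max (range x))" using e by simp
    moreover have "real (x i) \<le> real (x i - K) + real K" by linarith
    ultimately show ?thesis using True C0 by simp
  next
    case False
    let ?n = "x (\<phi> x i)"
    have "nbr_max x i > 0" using False K by linarith
    then obtain k where k: "\<rho> i k > 0" "x k = nbr_max x i" by (rule nbr_max_attained)
    have n: "nbr_max x i \<le> ?n" using m[of i k x] k False K by simp
    have "\<rho> i (\<phi> x i) > 0" using policy_useful(1)[of i k x] k False K by simp
    then have ml: "miss x i * (1 + real ?n * r) \<le> 1" using r by (intro miss_le) auto
    then have "r * (miss x i * real ?n) \<le> 1" using miss_bounds[of x i] by (simp add: algebra_simps)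
    then have 1: "miss x i * real ?n \<le> 1 / r" using r by (simp add: field_simps)
    have "miss x i \<le> e / 2"
    proof (rule ccontr)
      assume "\<not> miss x i \<le> e / 2"
      then have gt: "e / 2 < miss x i" by simp
      have "1 \<le> e / 2 * (real K0 * r)" by (rule K0)
      also have "\<dots> \<le> miss x i * (real ?n * r)"
        using gt e r K n False by (intro mult_mono mult_right_mono) auto
      finally show False using ml gt e by (simp add: algebra_simps)
    qed
    then have 2: "miss x i * real (x i) \<le> e / 2 * real (Max (range x))"
      using e by (intro mult_mono) auto
    have "real (nbr_max x i - K) \<le> real ?n" using n by simp
    then show ?thesis using False 1 2 C0 by (simp add: left_diff_distrib)
  qed
  have drift: "measure_pmf.expectation (step_pmf x) (\<lambda>y. \<Sum>j\<in>UNIV. (real (y j))\<^sup>2)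
      \<le> (\<Sum>j\<in>UNIV. (real (x j))\<^sup>2) + (1 + 2 * (C0 + e * real K)) - e * real (Max (range x))" for x
  proof -
    let ?V = "\<lambda>y :: 'c \<Rightarrow> nat. \<Sum>j\<in>UNIV. (real (y j))\<^sup>2"
    let ?T = "Max (range x)"
    let ?c = "C0 + e / 2 * real ?T"
    let ?d = "\<lambda>i. (1 - miss x i) * real (x (\<phi> x i)) - miss x i * real (x i)"
    let ?s = "\<lambda>i. real (nbr_max x i - K) - (if nbr_max x i < K then real (x i - K) else 0)"
    have "e * (real ?T - real K) \<le> e * real (?T - K)" using e by (intro mult_left_mono) auto
    also have "\<dots> \<le> (\<Sum>i\<in>UNIV. pmf \<nu> i * ?s i)" unfolding e_def by (rule static_gap[OF p(3)])
    also have "\<dots> = (\<Sum>i\<in>UNIV. pmf \<nu> i * (?s i - ?c)) + ?c"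
      unfolding sum_pmf_diff_const by simp
    also have "\<dots> \<le> (\<Sum>i\<in>UNIV. pmf \<nu> i * ?d i) + ?c"
      by (intro add_right_mono sum_mono mult_left_mono pointwise) simp
    finally have d: "e * real ?T \<le> 2 * (\<Sum>i\<in>UNIV. pmf \<nu> i * ?d i) + 2 * (C0 + e * real K)"
      by (simp add: algebra_simps)
    have step: "miss x i * ?V (x(i := x i + 1)) + (1 - miss x i) * ?V (x(\<phi> x i := x (\<phi> x i) - 1)) =
        ?V x + 1 - 2 * ?d i" for i
    proof -
      let ?j = "\<phi> x i"
      have up: "?V (x(i := x i + 1)) = ?V x + (2 * real (x i) + 1)"
        by (subst sum_fun_upd) (auto simp: power2_eq_square algebra_simps)
      have down: "(1 - miss x i) * ?V (x(?j := x ?j - 1)) = (1 - miss x i) * (?V x - 2 * real (x ?j) + 1)"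
      proof (cases "x ?j > 0")
        case True
        have "?V (x(?j := x ?j - 1)) = ?V x - 2 * real (x ?j) + 1"
          using True by (subst sum_fun_upd) (auto simp: power2_eq_square of_nat_diff algebra_simps)
        then show ?thesis by simp
      qed (simp add: miss_eq_1)
      show ?thesis unfolding up down by (simp add: algebra_simps)
    qed
    have "measure_pmf.expectation (step_pmf x) ?V = (\<Sum>i\<in>UNIV. pmf \<nu> i * (?V x + 1 - 2 * ?d i))"
      unfolding expectation_step_pmf step ..
    also have "\<dots> = ?V x + 1 - 2 * (\<Sum>i\<in>UNIV. pmf \<nu> i * ?d i)"
      by (rule sum_pmf_const_diff)
    finally show ?thesis using d by simp
  qed
  from that[OF e drift] show ?thesis .
qed

text \<open>A non-empty queue has a neighbouring class, whose arrival is matched with probability at least \<open>r\<close>.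
So the total goes down with probability at least \<open>p * r\<close>, and for \<open>\<theta> = p * r / 2\<close> this move alone
already doubles \<open>\<theta>\<close> to the power of the total.\<close>

lemma geometric_growth:
  obtains \<theta> :: real where "0 < \<theta>" "\<theta> < 1"
    "\<And>x. x \<noteq> (\<lambda>_. 0) \<Longrightarrow>
      2 * \<theta> ^ (\<Sum>j\<in>UNIV. x j) \<le> measure_pmf.expectation (step_pmf x) (\<lambda>y. \<theta> ^ (\<Sum>j\<in>UNIV. y j))"
proof -
  obtain r where r: "0 < r" "r \<le> 1" "\<And>i j. \<rho> i j > 0 \<Longrightarrow> r \<le> \<rho> i j" using edge_prob_lower_bound by blast
  obtain p where p: "0 < p" "p \<le> 1" "\<And>i. p \<le> pmf \<nu> i" using class_prob_lower_bound by blast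
  define \<theta> where "\<theta> = p * r / 2"
  have "p * r \<le> 1" using p r by (simp add: mult_le_one)
  then have \<theta>: "0 < \<theta>" "\<theta> < 1" using p r by (auto simp: \<theta>_def)
  have grow: "2 * \<theta> ^ (\<Sum>j\<in>UNIV. x j) \<le> measure_pmf.expectation (step_pmf x) (\<lambda>y. \<theta> ^ (\<Sum>j\<in>UNIV. y j))"
    if x: "x \<noteq> (\<lambda>_. 0)" for x
  proof -
    obtain k where k: "x k > 0" using x by (auto simp: fun_eq_iff)
    obtain i where i: "\<rho> i k > 0" by (rule has_neighbour)
    let ?j = "\<phi> x i" and ?x = "x(\<phi> x i := x (\<phi> x i) - 1)"
    have j: "\<rho> i ?j > 0" "x ?j > 0" using policy_useful[of i k x] i k by auto
    have "(1 - \<rho> i ?j) ^ x ?j \<le> (1 - \<rho> i ?j) ^ 1"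
      using j prob_range[of i ?j] by (intro power_decreasing) auto
    then have hit: "r \<le> 1 - miss x i" using r(3)[OF j(1)] by (simp add: miss_def)
    have "real (\<Sum>j\<in>UNIV. ?x j) = real (\<Sum>j\<in>UNIV. x j) - 1"
      using sum_fun_upd[of UNIV real x ?j "x ?j - 1"] j(2)
      by (simp add: of_nat_diff del: fun_upd_apply)
    then have Suc: "(\<Sum>j\<in>UNIV. x j) = Suc (\<Sum>j\<in>UNIV. ?x j)" by linarith
    let ?term = "\<lambda>i. pmf \<nu> i * (miss x i * \<theta> ^ (\<Sum>j\<in>UNIV. (x(i := x i + 1)) j) +
        (1 - miss x i) * \<theta> ^ (\<Sum>j\<in>UNIV. (x(\<phi> x i := x (\<phi> x i) - 1)) j))"
    have nonneg: "0 \<le> ?term l" for l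
      using miss_bounds[of x l] \<theta> by (intro mult_nonneg_nonneg add_nonneg_nonneg zero_le_power) auto
    have "2 * \<theta> ^ (\<Sum>j\<in>UNIV. x j) = p * (r * \<theta> ^ (\<Sum>j\<in>UNIV. ?x j))"
      by (simp only: Suc) (simp add: \<theta>_def del: fun_upd_apply)
    also have "\<dots> \<le> pmf \<nu> i * ((1 - miss x i) * \<theta> ^ (\<Sum>j\<in>UNIV. ?x j))"
      using p r hit \<theta> by (intro mult_mono mult_right_mono mult_nonneg_nonneg zero_le_power) auto
    also have "\<dots> \<le> ?term i"
      using miss_bounds[of x i] \<theta> by (intro mult_left_mono) (auto simp del: fun_upd_apply)
    also have "\<dots> \<le> (\<Sum>i\<in>UNIV. ?term i)" by (rule member_le_sum) (use nonneg in auto)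
    finally show ?thesis unfolding expectation_step_pmf .
  qed
  from that[OF \<theta> grow] show ?thesis .
qed

text \<open>The sum of squares decreases by at least \<open>1\<close> in mean where some queue has length at least \<open>R\<close>.  The other states have a total
of at most \<open>CARD('c) * R\<close>, so \<open>\<theta>\<close> to the power of the total is bounded below on them; \<open>B\<close> is chosen so
that the mean gain \<open>B * \<theta> ^ (\<Sum>\<^sub>j x j)\<close> from the bounded term covers there the possible increase \<open>C\<close> and the required unit of decrease.\<close>

lemma foster_function:
  obtains W :: "('c \<Rightarrow> nat) \<Rightarrow> real" where "\<And>x. 0 \<le> W x"
    "\<And>x. x \<noteq> (\<lambda>_. 0) \<Longrightarrow> measure_pmf.expectation (step_pmf x) W \<le> W x - 1"
proof -
  let ?V = "\<lambda>y :: 'c \<Rightarrow> nat. \<Sum>j\<in>UNIV. (real (y j))\<^sup>2"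
  let ?size = "\<lambda>y :: 'c \<Rightarrow> nat. \<Sum>j\<in>UNIV. y j"
  obtain C e where e: "0 < e" and V: "\<And>x. measure_pmf.expectation (step_pmf x) ?V
    \<le> ?V x + C - e * real (Max (range x))" using quadratic_drift by blast
  obtain \<theta> :: real where \<theta>: "0 < \<theta>" "\<theta> < 1" and grow: "\<And>x. x \<noteq> (\<lambda>_. 0) \<Longrightarrow>
      2 * \<theta> ^ ?size x \<le> measure_pmf.expectation (step_pmf x) (\<lambda>y. \<theta> ^ ?size y)"
    using geometric_growth by blast
  obtain R :: nat where R: "(C + 1) / e < real R" using reals_Archimedean2 by blast
  define B where "B = \<bar>C + 1\<bar> / \<theta> ^ (CARD('c) * R)"
  have B: "0 \<le> B" using \<theta> by (simp add: B_def)
  define W where "W y = ?V y + B * (1 - \<theta> ^ ?size y)" for y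
  have pos: "0 \<le> W x" for x
    using B \<theta> by (auto simp: W_def power_le_one intro!: add_nonneg_nonneg mult_nonneg_nonneg sum_nonneg)
  have drift: "measure_pmf.expectation (step_pmf x) W \<le> W x - 1" if x: "x \<noteq> (\<lambda>_. 0)" for x
  proof -
    have int: "integrable (measure_pmf (step_pmf x)) f" for f :: "_ \<Rightarrow> real"
      by (rule integrable_measure_pmf_finite[OF finite_set_step_pmf])
    have "measure_pmf.expectation (step_pmf x) W = measure_pmf.expectation (step_pmf x) ?V +
        B * (1 - measure_pmf.expectation (step_pmf x) (\<lambda>y. \<theta> ^ ?size y))"
      unfolding W_def by (simp add: int)
    also have "\<dots> \<le> (?V x + C - e * real (Max (range x))) + B * (1 - 2 * \<theta> ^ ?size x)"
      using grow[OF x] B by (intro add_mono V mult_left_mono) auto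
    finally have le: "measure_pmf.expectation (step_pmf x) W \<le>
        W x + (C - e * real (Max (range x)) - B * \<theta> ^ ?size x)"
      by (simp add: W_def algebra_simps)
    have "C + 1 \<le> e * real (Max (range x)) + B * \<theta> ^ ?size x"
    proof (cases "R \<le> Max (range x)")
      case True
      have "C + 1 \<le> e * real R" using R e by (simp add: field_simps)
      also have "\<dots> \<le> e * real (Max (range x))" using True e by simp
      finally show ?thesis using B \<theta> by (simp add: add_increasing2)
    next
      case False
      have "x j \<le> Max (range x)" for j by simp
      then have "x j \<le> R" for j using False by (meson nle_le order_trans)
      then have "?size x \<le> CARD('c) * R" using sum_bounded_above[of UNIV x R] by simp
      then have "\<theta> ^ (CARD('c) * R) \<le> \<theta> ^ ?size x" using \<theta> by (intro power_decreasing) auto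
      then have "B * \<theta> ^ (CARD('c) * R) \<le> B * \<theta> ^ ?size x" using B by (rule mult_left_mono)
      moreover have "B * \<theta> ^ (CARD('c) * R) = \<bar>C + 1\<bar>" using \<theta> by (simp add: B_def)
      moreover have "0 \<le> e * real (Max (range x))" using e by simp
      ultimately show ?thesis by linarith
    qed
    with le show ?thesis by linarith
  qed
  from that[OF pos drift] show ?thesis .
qed

end

section \<open>Perfect matchings occur infinitely often or finitely often\<close>

theorem corollary3p3:
  fixes \<nu> :: "'c::finite pmf"
    and \<rho> :: "'c \<Rightarrow> 'c \<Rightarrow> real"
    and w :: "nat \<Rightarrow> real \<Rightarrow> real"
    and \<alpha> :: "'c \<Rightarrow> nat"
    and sel :: "'c config \<Rightarrow> 'c \<Rightarrow> nat set \<Rightarrow> nat pmf"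
    and M :: "'w measure"
    and G :: "nat \<Rightarrow> 'w \<Rightarrow> 'c config"
  assumes "\<And>i. pmf \<nu> i > 0"
    and "\<And>i j. \<rho> i j \<in> {0..1}"
    and "\<And>i j. \<rho> i j = \<rho> j i"
    and "weight_function w"
    and "bij_betw \<alpha> UNIV {1..CARD('c)}"
    and "selection_rule w \<rho> \<alpha> sel"
    and "online_matching \<nu> \<rho> w \<alpha> sel M G"
  shows "(ncond_eta \<nu> \<rho> > 0 \<longrightarrow>
            measure M {\<omega> \<in> space M. \<exists>\<^sub>\<infinity>t. unmatched_count (G t \<omega>) = (\<lambda>_. 0)} = 1) \<and>
         (ncond_eta \<nu> \<rho> < 0 \<longrightarrow>
            measure M {\<omega> \<in> space M. \<exists>\<^sub>\<infinity>t. unmatched_count (G t \<omega>) = (\<lambda>_. 0)} = 0)"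
proof -
  interpret block_model_matching \<nu> \<rho> w \<alpha>
    using assms(1-5) by unfold_locales (auto simp: bij_betw_def)
  have "transition \<nu> \<rho> w \<alpha> = (\<lambda>x. pmf (step_pmf x))" by (rule ext) (rule transition_eq_pmf_step)
  with markov_chain_unmatched_count[OF assms(2,6,7)]
  have mc: "markov_chain M (\<lambda>t \<omega>. unmatched_count (G t \<omega>)) (\<lambda>_. 0) (\<lambda>x. pmf (step_pmf x))" by simp
  show ?thesis
  proof (intro conjI impI)
    assume "ncond_eta \<nu> \<rho> > 0"
    from ereal_dense2[OF this]
    obtain \<epsilon> where \<epsilon>: "0 < ereal \<epsilon>" "ereal \<epsilon> < ncond_eta \<nu> \<rho>" by blast
    interpret ncond_matching \<nu> \<rho> w \<alpha> \<epsilon>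
    proof
      show "0 < \<epsilon>" using \<epsilon>(1) by simp
      fix I :: "'c set" assume I: "I \<noteq> {}" "root_independent \<rho> I"
      have "ncond_eta \<nu> \<rho> \<le> ereal ((\<Sum>j\<in>root_nbhd \<rho> I. pmf \<nu> j) - (\<Sum>i\<in>I. pmf \<nu> i))"
        unfolding ncond_eta_def by (rule INF_lower) (use I in simp)
      then have "ereal \<epsilon> < ereal ((\<Sum>j\<in>root_nbhd \<rho> I. pmf \<nu> j) - (\<Sum>i\<in>I. pmf \<nu> i))"
        using \<epsilon>(2) by (rule less_le_trans[rotated])
      then show "(\<Sum>i\<in>I. pmf \<nu> i) + \<epsilon> \<le> (\<Sum>j\<in>root_nbhd \<rho> I. pmf \<nu> j)" by simp
    qed
    obtain W :: "('c \<Rightarrow> nat) \<Rightarrow> real" where "\<And>x. 0 \<le> W x"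
      "\<And>x. x \<noteq> (\<lambda>_. 0) \<Longrightarrow> measure_pmf.expectation (step_pmf x) W \<le> W x - 1" using foster_function by blast
    then show "measure M {\<omega> \<in> space M. \<exists>\<^sub>\<infinity>t. unmatched_count (G t \<omega>) = (\<lambda>_. 0)} = 1"
      by (rule markov_chain_recurrent_if_drift[OF mc finite_set_step_pmf])
  next
    assume "ncond_eta \<nu> \<rho> < 0"
    then obtain I where I: "root_independent \<rho> I"
      "ereal ((\<Sum>j\<in>root_nbhd \<rho> I. pmf \<nu> j) - (\<Sum>i\<in>I. pmf \<nu> i)) < 0"
      unfolding ncond_eta_def INF_less_iff by auto
    then have deficit: "(\<Sum>j\<in>root_nbhd \<rho> I. pmf \<nu> j) < (\<Sum>i\<in>I. pmf \<nu> i)" by simp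
    obtain \<theta> r where \<theta>: "0 < \<theta>" and r: "0 \<le> r" "r < 1"
      and contr: "\<And>x. measure_pmf.expectation (step_pmf x) (\<lambda>y. \<theta> powr excess I y)
        \<le> r * \<theta> powr excess I x"
      using excess_contraction[OF I(1) deficit] by blast
    show "measure M {\<omega> \<in> space M. \<exists>\<^sub>\<infinity>t. unmatched_count (G t \<omega>) = (\<lambda>_. 0)} = 0"
      by (rule markov_chain_transient_if_contraction[OF mc finite_set_step_pmf _ _ r contr])
        (use \<theta> in auto)
  qed
qed

end
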